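(* Let $G>I$ be a finite group with $Z(G)=I$ and $\sigma_1,\sigma_2\in G$ with $G=\langle\sigma_1,\sigma_2\rangle$, $\sigma_1\sigma_2\sigma_1=\sigma_2\sigma_1\sigma_2$, $o(\sigma_1\sigma_2\sigma_1)=2$, $C=[\sigma_1]$, and let $[\underline{\sigma}]=[\sigma_1,\sigma_2,\sigma_1,\sigma_1,\sigma_2,\sigma_1]$ (a generating $6$-system). Then $$Z_{40}=[\underline{\sigma}]^{B_6}=[\underline{\sigma}]^{H_6}\subseteq\Sigma^i(C,C,C,C,C,C)$$ is an orbit of length $40$ under the action of $B_6$ and also under the action of $H_6$, such that $\rho_6(\beta_{ij})$ has cycle type $(1)^{13}(3)^9$ for all $1\le i<j\le 6$, $\rho_6(B_6)\cong S_4(3)$, $\rho_6(\beta_j)$ has cycle type $(1)^{13}(3)^9$ for $2\le j\le 6$, $\rho_6(H_6)\cong S_4(3)$, and the genus is $g_{Z_{40}}=6$.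
   Context: $\iota$ is the identity and $I$ the trivial group. For conjugacy classes $C_1,\dots,C_m$, $\Sigma^i(C_1,\dots,C_m)$ is the set of $G$-conjugacy classes $[\sigma_1,\dots,\sigma_m]$ (simultaneous conjugation) of tuples with $\sigma_j\in C_j$, $\langle\sigma_1,\dots,\sigma_m\rangle=G$, $\sigma_1\cdots\sigma_m=\iota$. The Hurwitz braid group $H_m$ is generated by $\beta_2,\dots,\beta_m$ with relations $\beta_i\beta_j=\beta_j\beta_i$ ($|i-j|>1$), $\beta_i\beta_{i+1}\beta_i=\beta_{i+1}\beta_i\beta_{i+1}$, $\beta_2\cdots\beta_{m-1}\beta_m^2\beta_{m-1}\cdots\beta_2=1$, and acts from the right by $[\underline{\sigma}]^{\beta_i}=[\sigma_1,\dots,\sigma_{i-2},\sigma_{i-1}\sigma_i\sigma_{i-1}^{-1},\sigma_{i-1},\sigma_{i+1},\dots,\sigma_m]$. The pure braid group $B_m$ is generated by $\beta_{ij}=\beta_{i+1}^{-1}\cdots\beta_{j-1}^{-1}\beta_j^2\beta_{j-1}\cdots\beta_{i+1}$, $1\le i<j\le m$. $\rho_m$ denotes the induced permutation representation on the orbit. For a $B_m$-orbit $Z$, $g_Z=1-|Z|+\frac12\big((m-1)|Z|-\sum_{j=2}^m z_{1j}\big)$ with $z_{1j}$ the number of cycles (fixed points included) of $\rho_m(\beta_{1j})$ on $Z$. $S_4(3)=PSp_4(3)$ is the projective symplectic group of dimension $4$ over $\mathbb{F}_3$; cycle type $(1)^{13}(3)^9$ means $13$ fixed points and $9$ three-cycles.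 *)

theory Defs
  imports "HOL-Algebra.Algebra" "HOL-Analysis.Finite_Cartesian_Product" "HOL-Library.Multiset"
begin

section \<open>Tuples, Nielsen classes and the Hurwitz action\<close>

text \<open>Conjugate g x g^-1.\<close>
definition conjg :: "('a, 'b) monoid_scheme \<Rightarrow> 'a \<Rightarrow> 'a \<Rightarrow> 'a" where
  "conjg G g x = g \<otimes>\<^bsub>G\<^esub> x \<otimes>\<^bsub>G\<^esub> inv\<^bsub>G\<^esub> g"

text \<open>Conjugacy class of an element.\<close>
definition conj_class :: "('a, 'b) monoid_scheme \<Rightarrow> 'a \<Rightarrow> 'a set" where
  "conj_class G s = {conjg G g s | g. g \<in> carrier G}"

text \<open>Simultaneous conjugacy class [t] of a tuple t (a list).\<close>
definition tuple_class :: "('a, 'b) monoid_scheme \<Rightarrow> 'a list \<Rightarrow> 'a list set" where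
  "tuple_class G t = {map (conjg G g) t | g. g \<in> carrier G}"

text \<open>Product sigma_1 ... sigma_m.\<close>
definition tuple_prod :: "('a, 'b) monoid_scheme \<Rightarrow> 'a list \<Rightarrow> 'a" where
  "tuple_prod G t = foldr (\<lambda>x y. x \<otimes>\<^bsub>G\<^esub> y) t \<one>\<^bsub>G\<^esub>"

text \<open>Generating systems with product one in the given classes C_1,...,C_m.\<close>
definition gen_systems :: "('a, 'b) monoid_scheme \<Rightarrow> 'a set list \<Rightarrow> 'a list set" where
  "gen_systems G Cs = {t. length t = length Cs \<and> (\<forall>j < length Cs. t ! j \<in> Cs ! j)
      \<and> generate G (set t) = carrier G \<and> tuple_prod G t = \<one>\<^bsub>G\<^esub>}"

text \<open>Sigma^i(C_1,...,C_m): the set of classes [sigma].\<close>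
definition Sigma_i :: "('a, 'b) monoid_scheme \<Rightarrow> 'a set list \<Rightarrow> 'a list set set" where
  "Sigma_i G Cs = tuple_class G ` gen_systems G Cs"

text \<open>Hurwitz generator beta_i (2 <= i <= m, 1-based) acting on a tuple:
  positions i-1, i (1-based) become (s_{i-1} s_i s_{i-1}^-1, s_{i-1}).
  Its inverse sends them to (s_i, s_i^-1 s_{i-1} s_i).\<close>
definition hur_tup :: "('a, 'b) monoid_scheme \<Rightarrow> nat \<Rightarrow> 'a list \<Rightarrow> 'a list" where
  "hur_tup G i t = t[i - 2 := conjg G (t ! (i - 2)) (t ! (i - 1)), i - 1 := t ! (i - 2)]"

definition hur_tup_inv :: "('a, 'b) monoid_scheme \<Rightarrow> nat \<Rightarrow> 'a list \<Rightarrow> 'a list" where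
  "hur_tup_inv G i t = t[i - 2 := t ! (i - 1), i - 1 := conjg G (inv\<^bsub>G\<^esub> (t ! (i - 1))) (t ! (i - 2))]"

text \<open>A letter (i, b) stands for beta_i if b = False and beta_i^-1 if b = True;
  it acts on a class [t] (a set of tuples) elementwise.\<close>
definition hstep :: "('a, 'b) monoid_scheme \<Rightarrow> nat * bool \<Rightarrow> 'a list set \<Rightarrow> 'a list set" where
  "hstep G l Y = (if snd l then hur_tup_inv G (fst l) ` Y else hur_tup G (fst l) ` Y)"

text \<open>Right action of a word (applied from left to right).\<close>
definition wact :: "('a, 'b) monoid_scheme \<Rightarrow> (nat * bool) list \<Rightarrow> 'a list set \<Rightarrow> 'a list set" where
  "wact G w Y = fold (hstep G) w Y"

definition inv_word :: "(nat * bool) list \<Rightarrow> (nat * bool) list" where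
  "inv_word w = rev (map (\<lambda>(i, b). (i, \<not> b)) w)"

text \<open>beta_j\<close>
definition beta_word :: "nat \<Rightarrow> (nat * bool) list" where
  "beta_word j = [(j, False)]"

text \<open>beta_ij = beta_{i+1}^-1 ... beta_{j-1}^-1 beta_j^2 beta_{j-1} ... beta_{i+1}\<close>
definition beta_ij_word :: "nat \<Rightarrow> nat \<Rightarrow> (nat * bool) list" where
  "beta_ij_word i j = map (\<lambda>k. (k, True)) [Suc i..<j] @ [(j, False), (j, False)]
      @ map (\<lambda>k. (k, False)) (rev [Suc i..<j])"

text \<open>Generators of the Hurwitz braid group H_m and the pure braid group B_m.\<close>
definition H_gens :: "nat \<Rightarrow> (nat * bool) list set" where
  "H_gens m = {beta_word j | j. 2 \<le> j \<and> j \<le> m}"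

definition B_gens :: "nat \<Rightarrow> (nat * bool) list set" where
  "B_gens m = {beta_ij_word i j | i j. 1 \<le> i \<and> i < j \<and> j \<le> m}"

text \<open>Orbit of Y under the group generated by a set of generators Ws.\<close>
definition orbit_gen :: "('a, 'b) monoid_scheme \<Rightarrow> (nat * bool) list set \<Rightarrow> 'a list set \<Rightarrow> 'a list set set" where
  "orbit_gen G Ws Y = {wact G (concat ws) Y | ws. ws \<in> lists (Ws \<union> inv_word ` Ws)}"

text \<open>The permutation rho(w) induced on an orbit Z.\<close>
definition rho :: "('a, 'b) monoid_scheme \<Rightarrow> 'a list set set \<Rightarrow> (nat * bool) list \<Rightarrow> 'a list set \<Rightarrow> 'a list set" where
  "rho G Z w = (\<lambda>Y \<in> Z. wact G w Y)"

text \<open>The permutation group rho(<Ws>) as a subgroup of Sym(Z).\<close>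
definition rho_group :: "('a, 'b) monoid_scheme \<Rightarrow> 'a list set set \<Rightarrow> (nat * bool) list set
    \<Rightarrow> ('a list set \<Rightarrow> 'a list set) monoid" where
  "rho_group G Z Ws = (BijGroup Z)\<lparr>carrier := generate (BijGroup Z) (rho G Z ` Ws)\<rparr>"

section \<open>Cycle types\<close>

definition cycles_on :: "('c \<Rightarrow> 'c) \<Rightarrow> 'c set \<Rightarrow> 'c set set" where
  "cycles_on f Z = (\<lambda>x. {(f ^^ n) x | n. True}) ` Z"

text \<open>Multiset of cycle lengths (fixed points counted as cycles of length 1).\<close>
definition cycle_type :: "('c \<Rightarrow> 'c) \<Rightarrow> 'c set \<Rightarrow> nat multiset" where
  "cycle_type f Z = image_mset card (mset_set (cycles_on f Z))"

text \<open>Genus g_Z = 1 - |Z| + ((m-1)|Z| - sum_{j=2}^m z_{1j}) / 2.\<close>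
definition genus :: "('a, 'b) monoid_scheme \<Rightarrow> nat \<Rightarrow> 'a list set set \<Rightarrow> real" where
  "genus G m Z = 1 - real (card Z)
     + (real (m - 1) * real (card Z) - (\<Sum>j = 2..m. real (card (cycles_on (rho G Z (beta_ij_word 1 j)) Z)))) / 2"

section \<open>The group S_4(3) = PSp_4(3)\<close>

text \<open>Standard symplectic form on F_3^4 (F_3 is the numeral type 3).\<close>
definition sympJ :: "3^4^4" where
  "sympJ = (\<chi> i j. if i = 0 \<and> j = 2 then 1 else if i = 1 \<and> j = 3 then 1
               else if i = 2 \<and> j = 0 then -1 else if i = 3 \<and> j = 1 then -1 else 0)"

definition Sp43 :: "(3^4^4) monoid" where
  "Sp43 = \<lparr>carrier = {A. transpose A ** sympJ ** A = sympJ}, monoid.mult = (**), one = mat 1\<rparr>"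

text \<open>PSp_4(3) = Sp_4(3) / Z(Sp_4(3)), Z(Sp_4(3)) = {I, -I}.\<close>
definition PSp43 :: "(3^4^4) set monoid" where
  "PSp43 = Sp43 Mod {mat 1, - mat 1}"

end

theory Submission
  imports Defs "HOL-Analysis.Cartesian_Space"
begin

text \<open>Since \<open>s1 s2 s1\<close> is an involution, \<open>G\<close> is a quotient of the modular group
  \<open>\<langle>s, t | s\<^sup>2 = t\<^sup>3 = 1\<rangle>\<close> with \<open>s = s1 s2 s1\<close> and \<open>t = s1 s2\<close>. Already in the modular group
  the braid orbit consists of 40 classes, which can be labelled by the points of the projective
  space \<open>P\<^sup>3(F\<^sub>3)\<close> in such a way that each \<open>\<beta>\<^sub>i\<close> acts as a symplectic transvection. The classes
  stay distinct in \<open>G\<close>: the transvections generate a group that is transitive on hyperbolic pairs,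
  so any coincidence of two classes spreads to one that forces \<open>s1 = s2\<close>, which contradicts the
  triviality of the centre. The same transitivity shows that transvections generate \<open>Sp\<^sub>4(3)\<close>, so
  the permutation group on the orbit is \<open>Sp\<^sub>4(3)\<close> modulo the matrices that fix every line. On the
  orbit \<open>\<beta>\<^sub>i\<close> has order three, hence is itself a power of \<open>\<beta>\<^sub>i\<^sup>2\<close>, and the pure braid group has the
  same image as the full braid group.\<close>

section \<open>The orbit in the modular group\<close>

text \<open>Reduced words in the modular group: \<open>S\<close> has order two and \<open>U\<close> is the square and inverse of \<open>T\<close>.
  The words \<open>wa\<close> and \<open>wb\<close> below stand for \<open>s1\<close> and \<open>s2\<close>, the words \<open>wc\<close> and \<open>wd\<close> for \<open>s1 s2 s1\<^sup>-\<^sup>1\<close> and \<open>s2 s1 s2\<^sup>-\<^sup>1\<close>.\<close>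

datatype letter = S | T | U

text \<open>Multiplying a letter onto a reduced word gives a reduced word, so computations in the
  modular group become equalities of lists, which evaluation can decide.\<close>

fun lmul :: "letter \<Rightarrow> letter list \<Rightarrow> letter list" where
  "lmul S (S # w) = w"
| "lmul T (T # w) = U # w"
| "lmul T (U # w) = w"
| "lmul U (T # w) = w"
| "lmul U (U # w) = T # w"
| "lmul x w = x # w"

fun linv :: "letter \<Rightarrow> letter" where
  "linv S = S"
| "linv T = U"
| "linv U = T"

definition wmul :: "letter list \<Rightarrow> letter list \<Rightarrow> letter list" where
  "wmul u w = foldr lmul u w"

definition winv :: "letter list \<Rightarrow> letter list" where
  "winv w = rev (map linv w)"

definition wconj :: "letter list \<Rightarrow> letter list \<Rightarrow> letter list" where
  "wconj g x = wmul (wmul g x) (winv g)"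

definition whur :: "nat \<Rightarrow> letter list list \<Rightarrow> letter list list" where
  "whur i t = t[i - 2 := wconj (t ! (i - 2)) (t ! (i - 1)), i - 1 := t ! (i - 2)]"

definition wa :: "letter list" where "wa = [U, S]"
definition wb :: "letter list" where "wb = [S, U]"
definition wc :: "letter list" where "wc = [T, S, T]"
definition wd :: "letter list" where "wd = [S, T, S, T, S]"

text \<open>The tables come from a breadth-first enumeration of the orbit. The rows of \<open>target_table\<close>
  and \<open>conjugator_table\<close> belong to \<open>\<beta>\<^sub>2, \<dots>, \<beta>\<^sub>6\<close>: applied to entry \<open>k\<close> of \<open>tuple_table\<close>, the braid
  yields the conjugate, by the given word, of the target entry. The targets are of type \<open>int\<close>
  because numerals of type \<open>nat\<close> become unary under \<open>code_simp\<close>. The labels represent points of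
  \<open>P\<^sup>3(F\<^sub>3)\<close> by vectors with entries \<open>-1, 0, 1\<close>; entry 0 is the centre of the transvection \<open>\<beta>\<^sub>2\<close>, and
  entry 33 belongs to the tuple \<open>(s1, s2, s1, s1, s2, s1)\<close>.\<close>

definition tuple_table :: "letter list list list" where
  "tuple_table = [
    [wd,wc,wa,wa,wa,wa], [wd,wb,wc,wa,wa,wa], [wb,wc,wd,wb,wb,wb], [wb,wa,wc,wa,wa,wa],
    [wd,wb,wb,wc,wa,wa], [wb,wc,wa,wd,wb,wb], [wb,wa,wb,wc,wa,wa], [wc,wa,wb,wa,wb,wb],
    [wd,wb,wb,wb,wc,wa], [wb,wb,wc,wd,wb,wb], [wb,wc,wb,wa,wb,wb], [wb,wc,wa,wa,wd,wb],
    [wb,wa,wa,wb,wa,wa], [wb,wa,wb,wb,wc,wa], [wb,wb,wc,wc,wa,wa], [wb,wc,wa,wb,wc,wa],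
    [wc,wa,wa,wb,wa,wb], [wd,wb,wb,wb,wb,wc], [wb,wb,wc,wa,wd,wb], [wa,wb,wa,wb,wc,wa],
    [wb,wc,wa,wb,wa,wb], [wb,wc,wa,wa,wa,wd], [wa,wb,wb,wc,wa,wb], [wb,wa,wb,wa,wb,wa],
    [wb,wa,wb,wb,wb,wc], [wa,wa,wb,wa,wb,wc], [wb,wc,wa,wa,wb,wa], [wa,wb,wc,wa,wa,wb],
    [wa,wb,wa,wb,wb,wc], [wc,wa,wa,wa,wb,wa], [wb,wb,wb,wc,wd,wb], [wb,wb,wc,wb,wa,wb],
    [wb,wb,wc,wa,wa,wd], [wa,wb,wa,wa,wb,wa], [wb,wc,wc,wa,wa,wb], [wb,wb,wc,wa,wb,wa],
    [wb,wb,wa,wb,wb,wa], [wb,wb,wb,wc,wa,wd], [wb,wb,wb,wc,wb,wa], [wb,wb,wb,wb,wc,wd]]"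

definition target_table :: "int list list" where
  "target_table = [
    [
     0, 2, 3, 1, 5, 6, 4, 10, 11, 9, 12, 13, 7, 8, 14, 19, 20, 21, 18, 22, 23, 24, 15, 16, 17,
     25, 33, 28, 34, 26, 30, 31, 32, 29, 27, 35, 36, 37, 38, 39],
    [
     1, 3, 2, 0, 4, 9, 7, 14, 8, 10, 5, 18, 12, 15, 6, 25, 16, 17, 19, 11, 31, 32, 22, 26, 27,
     13, 35, 36, 21, 29, 30, 33, 28, 20, 34, 23, 24, 37, 38, 39],
    [
     0, 4, 5, 6, 7, 10, 12, 1, 8, 9, 2, 11, 3, 13, 14, 16, 28, 17, 30, 20, 34, 21, 23, 27, 24,
     32, 26, 22, 15, 29, 31, 18, 37, 33, 19, 38, 35, 25, 36, 39],
    [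
     0, 1, 2, 3, 8, 11, 13, 15, 16, 18, 19, 20, 22, 23, 25, 26, 4, 17, 31, 33, 5, 21, 29, 6,
     24, 35, 7, 27, 28, 12, 30, 9, 32, 10, 34, 14, 36, 39, 37, 38],
    [
     0, 1, 2, 3, 4, 5, 6, 7, 17, 9, 10, 21, 12, 24, 14, 27, 22, 29, 32, 28, 15, 26, 34, 19, 33,
     36, 11, 20, 23, 8, 37, 25, 35, 13, 16, 18, 31, 38, 30, 39]]"

definition conjugator_table :: "letter list list list" where
  "conjugator_table = [
    [
     [S,T,S,T], [S], [S], [], [S], [S], [], [], [S], [], [S], [S], [S], [], [], [], [], [S],
     [], [U], [S], [S], [T], [S], [], [], [], [U], [T], [], [], [], [], [], [], [], [], [], [],
     []],
    [
     [], [S,T], [T,S,T,S], [U,S], [], [], [U], [T], [], [S,U], [T,S], [], [], [], [], [T], [],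
     [], [S], [S], [], [], [], [], [T], [U], [], [S], [S], [], [], [S], [S], [S], [], [],
     [S,U], [], [], []],
    [
     [], [], [], [], [S], [], [], [S], [], [T,S,T,S], [], [], [], [], [], [U], [U], [], [],
     [U], [], [], [S], [S], [], [S], [], [], [U], [], [S,U], [T,S], [], [], [T], [], [], [S],
     [], []],
    [
     [], [], [], [], [], [], [], [T], [S], [], [T], [], [S], [], [T], [], [S], [], [], [], [],
     [], [T], [], [], [U], [U], [], [], [U,S], [T,S,T,S], [], [], [U], [], [], [], [], [T,S],
     [S,U]],
    [
     [], [], [], [], [], [], [], [], [], [], [], [], [], [], [], [T], [U], [S], [], [], [], [],
     [U], [S], [S], [S], [], [U], [S], [S], [], [T], [], [S], [U], [], [S,U], [], [], [T,S,T,S]]]"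

definition label_table :: "(int \<times> int \<times> int \<times> int) list" where
  "label_table = [
    (1,0,0,0), (1,0,1,0), (0,0,1,0), (1,0,-1,0), (0,1,-1,0), (1,1,-1,0), (1,-1,1,0),
    (1,-1,-1,0), (0,1,-1,1), (1,1,0,0), (1,1,1,0), (1,1,-1,1), (0,1,1,0), (1,-1,1,-1),
    (1,-1,0,0), (1,-1,-1,-1), (0,1,-1,-1), (0,0,1,-1), (1,1,0,1), (1,1,1,1), (1,1,-1,-1),
    (1,0,-1,1), (0,1,1,1), (1,-1,1,1), (1,0,1,-1), (1,-1,0,-1), (1,-1,-1,1), (1,0,-1,-1),
    (1,0,1,1), (0,1,1,-1), (0,0,0,1), (1,1,0,-1), (1,0,0,1), (1,1,1,-1), (0,0,1,1), (1,-1,0,1),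
    (1,0,0,-1), (0,1,0,-1), (0,1,0,1), (0,1,0,0)]"

definition target :: "nat \<Rightarrow> nat \<Rightarrow> nat" where
  "target i k = nat (target_table ! (i - 2) ! k)"

definition conjugator :: "nat \<Rightarrow> nat \<Rightarrow> letter list" where
  "conjugator i k = conjugator_table ! (i - 2) ! k"

text \<open>These equations live in the modular group, so one evaluation serves every quotient
  \<open>G\<close>. Quantifying over explicit lists makes the statement executable.\<close>

lemma whur_table:
  "\<forall>i\<in>set [2,3,4,5,6]. \<forall>k\<in>set [0..<40].
     whur i (tuple_table ! k) = map (wconj (conjugator i k)) (tuple_table ! target i k)"
  by code_simp

lemma length_table: "\<forall>k\<in>set [0..<40]. length (tuple_table ! k) = 6"
  by code_simp

lemma target_cube:
  "\<forall>i\<in>set [2,3,4,5,6]. \<forall>k\<in>set [0..<40].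
     target i k < 40 \<and> target i (target i (target i k)) = k"
  by code_simp

text \<open>The breadth-first order yields a spanning tree rooted at entry 0; it carries the
  induction that realizes the transvection along every label.\<close>

lemma parent_table:
  "\<forall>k\<in>set [1..<40]. \<exists>i\<in>set [2,3,4,5,6]. \<exists>l\<in>set [0..<k]. target i l = k"
  by code_simp

section \<open>Integer coordinates for the symplectic space over F_3\<close>

definition form4 :: "int \<times> int \<times> int \<times> int \<Rightarrow> int \<times> int \<times> int \<times> int \<Rightarrow> int" where
  "form4 = (\<lambda>(a,b,c,d) (a',b',c',d'). a * c' + b * d' - c * a' - d * b')"

text \<open>Neighbouring centres pair to 1 or -1 and all others to 0, so that the transvections
  satisfy the braid relation or commute, respectively.\<close>

definition centre4 :: "nat \<Rightarrow> int \<times> int \<times> int \<times> int" where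
  "centre4 i = [(1,0,0,0), (0,0,1,0), (1,1,0,0), (0,0,0,1), (0,1,0,0)] ! (i - 2)"

text \<open>The balanced residue modulo 3: it has the digits of \<open>label_table\<close>, so that
  quadruples can be compared literally.\<close>

definition bal :: "int \<Rightarrow> int" where "bal x = (x + 1) mod 3 - 1"

definition transv4 :: "int \<times> int \<times> int \<times> int \<Rightarrow> int \<times> int \<times> int \<times> int \<Rightarrow> int \<times> int \<times> int \<times> int" where
  "transv4 c v = (let w = form4 v c in case (v, c) of ((v1,v2,v3,v4), (c1,c2,c3,c4)) \<Rightarrow>
     (bal (v1 + w * c1), bal (v2 + w * c2), bal (v3 + w * c3), bal (v4 + w * c4)))"

definition neg4 :: "int \<times> int \<times> int \<times> int \<Rightarrow> int \<times> int \<times> int \<times> int" where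
  "neg4 = (\<lambda>(a,b,c,d). (-a,-b,-c,-d))"

text \<open>The sign is the ambiguity of a vector that represents a projective point. This check
  links the braid action on indices to linear algebra.\<close>

lemma transv_table:
  "\<forall>i\<in>set [2,3,4,5,6]. \<forall>k\<in>set [0..<40].
     transv4 (centre4 i) (label_table ! k) \<in> {label_table ! target i k, neg4 (label_table ! target i k)}"
  by code_simp

text \<open>The 40 labels and their negatives make up all 80 = 3^4 - 1 nonzero vectors, so that
  every line carries exactly one label.\<close>

lemma label_table_distinct: "distinct (label_table @ map neg4 label_table)"
  by code_simp

lemma label_table_cover:
  "\<forall>a\<in>set [-1,0,1]. \<forall>b\<in>set [-1,0,1]. \<forall>c\<in>set [-1,0,1]. \<forall>d\<in>set [-1,0,1].
    (a,b,c,d) = (0,0,0,0) \<or> (a,b,c,d) \<in> set (label_table @ map neg4 label_table)"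
  by code_simp

text \<open>As \<open>\<beta>\<^sub>i\<close> acts with order three, its inverse acts as its square.\<close>

definition act_letter :: "nat \<times> bool \<Rightarrow> nat \<Rightarrow> nat" where
  "act_letter l k = (if snd l then target (fst l) (target (fst l) k) else target (fst l) k)"

definition act_word :: "(nat \<times> bool) list \<Rightarrow> nat \<Rightarrow> nat" where
  "act_word w k = fold act_letter w k"

text \<open>A transvection fixes the 1 + 3 + 9 = 13 points of a projective plane and moves the other
  27 in 3-cycles. The braid \<open>beta_ij\<close> is conjugate to the square of
  \<open>beta_j\<close> and hence acts as a transvection too.\<close>

lemma beta_ij_table:
  "\<forall>j\<in>set [2,3,4,5,6]. \<forall>i\<in>set [1..<j]. 
     (\<forall>k\<in>set [0..<40]. act_word (beta_ij_word i j) (act_word (beta_ij_word i j) (act_word (beta_ij_word i j) k)) = k) \<and>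
     length (filter (\<lambda>k. act_word (beta_ij_word i j) k = k) [0..<40]) = 13"
  by code_simp

lemma beta_table:
  "\<forall>j\<in>set [2,3,4,5,6].
     length (filter (\<lambda>k. act_word (beta_word j) k = k) [0..<40]) = 13"
  by code_simp


lemma label_table_range:
  "\<forall>(a,b,c,d)\<in>set label_table. a \<in> set [-1,0,1] \<and> b \<in> set [-1,0,1] \<and> c \<in> set [-1,0,1] \<and> d \<in> set [-1,0,1]"
  by code_simp

lemma length_label_table: "length label_table = 40"
  by code_simp

section \<open>Symplectic geometry over the field with three elements\<close>

lemma F3_cases: "(x::3) = 0 \<or> x = 1 \<or> x = -1"
proof (cases x)
  case (of_int z)
  then have "z = 0 \<or> z = 1 \<or> z = 2" by auto
  then show ?thesis using of_int by (auto simp: eq_neg_iff_add_eq_0)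
qed

lemma F3_three [simp]: "(x::3) + x + x = 0"
  using F3_cases[of x] by auto

lemma F3_times_three [simp]: "3 * (x::3) = 0" "x * 3 = 0"
  using F3_cases[of x] by auto

lemma F3_square: "(x::3) \<noteq> 0 \<Longrightarrow> x * x = 1"
  using F3_cases[of x] by auto

lemma F3_minus_eq: "(x::3) = - x \<longleftrightarrow> x = 0"
  using F3_cases[of x] by auto

lemma ix4_cases: "(i::4) = 0 \<or> i = 1 \<or> i = 2 \<or> i = 3"
  using exhaust_4[of i] by auto

lemma all_ix4: "(\<forall>i::4. P i) \<longleftrightarrow> P 0 \<and> P 1 \<and> P 2 \<and> P 3"
  by (metis ix4_cases)

lemma sum_ix4: "sum f (UNIV::4 set) = f 0 + f 1 + f 2 + f 3"
proof -
  have "f 4 = f 0" by (rule arg_cong[where f = f]) simp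
  then show ?thesis unfolding sum_4 by (simp only: ac_simps)
qed

definition sform :: "3^4 \<Rightarrow> 3^4 \<Rightarrow> 3" where
  "sform u v = u$0 * v$2 + u$1 * v$3 - u$2 * v$0 - u$3 * v$1"

definition transv :: "3^4 \<Rightarrow> 3^4 \<Rightarrow> 3^4" where
  "transv c v = v + sform v c *s c"

lemma sform_simps [simp]:
  "sform (u + v) w = sform u w + sform v w"
  "sform w (u + v) = sform w u + sform w v"
  "sform (u - v) w = sform u w - sform v w"
  "sform w (u - v) = sform w u - sform w v"
  "sform (- u) w = - sform u w"
  "sform w (- u) = - sform w u"
  "sform (a *s u) w = a * sform u w"
  "sform w (a *s u) = a * sform w u"
  "sform u u = 0" "sform 0 u = 0" "sform u 0 = 0"
  by (simp_all add: sform_def algebra_simps)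

lemma sform_swap: "sform u v = - sform v u"
  by (simp add: sform_def algebra_simps)

lemma sform_eq_0_swap: "sform u v = 0 \<longleftrightarrow> sform v u = 0"
  by (metis sform_swap neg_equal_0_iff_equal)

lemma sform_axis:
  "sform u (axis 0 1) = - u$2" "sform u (axis 1 1) = - u$3"
  "sform u (axis 2 1) = u$0" "sform u (axis 3 1) = u$1"
  by (simp_all add: sform_def axis_def)

lemma vec4_eq_iff: "(u::'a^4) = v \<longleftrightarrow> u$0 = v$0 \<and> u$1 = v$1 \<and> u$2 = v$2 \<and> u$3 = v$3"
  by (simp add: vec_eq_iff all_ix4)

lemma sform_nondegenerate: "u \<noteq> 0 \<Longrightarrow> \<exists>y. sform u y \<noteq> 0"
  using sform_axis[of u] by (metis neg_equal_0_iff_equal vec4_eq_iff zero_index)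

lemma vec_F3_three: "(v::3^4) + v + v = 0"
  by (simp add: vec_eq_iff)

lemma transv_sform [simp]: "sform (transv c u) (transv c v) = sform u v"
  by (simp add: transv_def algebra_simps sform_swap[of c])

lemma transv_cube: "transv c (transv c (transv c v)) = v"
proof -
  have *: "sform (transv c w) c = sform w c" for w by (simp add: transv_def)
  have t: "transv c w = w + sform w c *s c" for w by (simp add: transv_def)
  have "transv c (transv c (transv c v)) = v + sform v c *s c + sform v c *s c + sform v c *s c"
    using t[of v] t[of "transv c v"] t[of "transv c (transv c v)"] * by metis
  also have "\<dots> = v" by (simp add: vec_eq_iff algebra_simps)
  finally show ?thesis .
qed

lemma transv_minus: "transv (- c) v = transv c v" "transv c (- v) = - transv c v"
  by (simp_all add: transv_def vec_eq_iff)

lemma transv_0 [simp]: "transv c 0 = 0"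
  by (simp add: transv_def)

lemma transv_eq_0_iff [simp]: "transv c v = 0 \<longleftrightarrow> v = 0"
  by (metis transv_0 transv_cube)

lemma transv_fix: "sform v c = 0 \<Longrightarrow> transv c v = v"
  by (simp add: transv_def)

text \<open>Conjugation moves the centre of a transvection; this is how the five given centres lead
  to all the others.\<close>

lemma transv_conj: "transv (transv c d) (transv c v) = transv c (transv d v)"
proof -
  have "transv c (transv d v) = transv c v + sform v d *s transv c d"
    by (simp add: transv_def vec_eq_iff algebra_simps)
  then show ?thesis by (simp add: transv_def[of "transv c d"])
qed

lemma fold_transv_sform [simp]: "sform (fold transv cs u) (fold transv cs v) = sform u v"
  by (induction cs arbitrary: u v) auto

lemma fold_transv_fix: "\<forall>c\<in>set cs. sform v c = 0 \<Longrightarrow> fold transv cs v = v"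
  by (induction cs) (auto simp: transv_fix)

lemma fold_transv_eq_0_iff [simp]: "fold transv cs v = 0 \<longleftrightarrow> v = 0"
  by (induction cs arbitrary: v) auto

section \<open>Transitivity of transvections on vectors and on hyperbolic pairs\<close>

lemma transv_move:
  assumes "sform u w \<noteq> 0"
  obtains cs where "set cs = {w - u}" "fold transv cs u = w"
proof -
  consider "sform u w = 1" | "sform u w = -1" using assms F3_cases by blast
  then show ?thesis
  proof cases
    case 1
    then show ?thesis by (intro that[of "[w - u]"]) (auto simp: transv_def)
  next
    case 2
    \<comment> \<open>Form value -1 calls for the inverse transvection, which is the square in
      characteristic 3.\<close>
    have "transv (w - u) (transv (w - u) u) = w"
      using 2 vec_F3_three[of u] vec_F3_three[of w]
      by (simp add: transv_def vec_eq_iff algebra_simps sform_swap[of w u])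
    then show ?thesis by (intro that[of "[w - u, w - u]"]) auto
  qed
qed

text \<open>There are two instances: the whole space and the orthogonal complement of a hyperbolic
  plane. Closure under scalars follows because F_3 is a prime field.\<close>

locale symp_space =
  fixes W :: "(3^4) set"
  assumes add_closed: "u \<in> W \<Longrightarrow> v \<in> W \<Longrightarrow> u + v \<in> W"
    and diff_closed: "u \<in> W \<Longrightarrow> v \<in> W \<Longrightarrow> u - v \<in> W"
    and nondegenerate: "u \<in> W \<Longrightarrow> u \<noteq> 0 \<Longrightarrow> \<exists>y\<in>W. sform u y \<noteq> 0"
begin

lemma scale_closed: "u \<in> W \<Longrightarrow> a *s u \<in> W"
proof -
  assume u: "u \<in> W"
  have "0 *s u = u - u" "1 *s u = u" "(-1) *s u = (u - u) - u" by (simp_all add: vec_eq_iff)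
  with u show ?thesis using F3_cases[of a] diff_closed by metis
qed

lemma transv_closed: "c \<in> W \<Longrightarrow> v \<in> W \<Longrightarrow> transv c v \<in> W"
  by (simp add: transv_def add_closed scale_closed)

lemma fold_transv_closed: "set cs \<subseteq> W \<Longrightarrow> v \<in> W \<Longrightarrow> fold transv cs v \<in> W"
  by (induction cs arbitrary: v) (auto simp: transv_closed)

text \<open>Two moves through a vector \<open>x\<close> that is orthogonal to neither
  \<open>u\<close> nor \<open>w\<close>: if neither \<open>y\<close> nor \<open>z\<close> qualifies,
  then \<open>y + z\<close> does.\<close>

lemma transitive:
  assumes "u \<in> W" "u \<noteq> 0" "w \<in> W" "w \<noteq> 0"
  shows "\<exists>cs. set cs \<subseteq> W \<and> fold transv cs u = w"
proof -
  obtain x where x: "x \<in> W" "sform u x \<noteq> 0" "sform x w \<noteq> 0"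
  proof -
    obtain y z where yz: "y \<in> W" "sform u y \<noteq> 0" "z \<in> W" "sform w z \<noteq> 0"
      using nondegenerate assms by metis
    have z: "sform z w \<noteq> 0" using yz(4) by (simp add: sform_eq_0_swap)
    consider "sform y w \<noteq> 0" | "sform u z \<noteq> 0" | "sform y w = 0" "sform u z = 0" by blast
    then show ?thesis
    proof cases
      case 3
      then show ?thesis using yz z by (intro that[of "y + z"]) (auto simp: add_closed)
    qed (use that yz z in blast)+
  qed
  obtain cs where cs: "set cs = {x - u}" "fold transv cs u = x" using transv_move x by blast
  obtain ds where ds: "set ds = {w - x}" "fold transv ds x = w" using transv_move x by blast
  show ?thesis
    by (rule exI[of _ "cs @ ds"]) (use cs ds x assms diff_closed in auto)
qed

text \<open>Vectors that pair equally with \<open>u\<close> have a difference orthogonal to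
  \<open>u\<close>, so the transvection centred at it fixes \<open>u\<close>. If \<open>v\<close>
  and \<open>v'\<close> are orthogonal, \<open>transv_move\<close> does not apply to them and
  \<open>u + v\<close> serves as intermediate vector.\<close>

lemma transitive_stabilizer:
  assumes "u \<in> W" "v \<in> W" "v' \<in> W" "sform u v = 1" "sform u v' = 1"
  shows "\<exists>cs. set cs \<subseteq> W \<and> fold transv cs u = u \<and> fold transv cs v = v'"
proof -
  have step: "\<exists>cs. set cs \<subseteq> W \<and> fold transv cs u = u \<and> fold transv cs a = b"
    if ab: "a \<in> W" "b \<in> W" "sform a b \<noteq> 0" "sform u a = 1" "sform u b = 1" for a b
  proof -
    obtain cs where "set cs = {b - a}" "fold transv cs a = b" using transv_move[OF ab(3)] by blast
    moreover from this have "fold transv cs u = u" using that by (intro fold_transv_fix) auto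
    ultimately show ?thesis using ab diff_closed by (intro exI[of _ cs]) simp
  qed
  show ?thesis
  proof (cases "sform v v' = 0")
    case False
    then show ?thesis using step assms by blast
  next
    case True
    have vu: "sform v u = -1" using assms sform_swap[of v u] by simp
    obtain cs where cs: "set cs \<subseteq> W" "fold transv cs u = u" "fold transv cs v = u + v"
      using step[of v "u + v"] assms vu by (auto simp: add_closed)
    obtain ds where ds: "set ds \<subseteq> W" "fold transv ds u = u" "fold transv ds (u + v) = v'"
      using step[of "u + v" v'] assms True by (auto simp: add_closed)
    show ?thesis by (rule exI[of _ "cs @ ds"]) (use cs ds in auto)
  qed
qed

lemma transitive_hyperbolic:
  assumes "u \<in> W" "v \<in> W" "u' \<in> W" "v' \<in> W" "sform u v = 1" "sform u' v' = 1"
  shows "\<exists>cs. set cs \<subseteq> W \<and> fold transv cs u = u' \<and> fold transv cs v = v'"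
proof -
  have "u \<noteq> 0" "u' \<noteq> 0" using assms by auto
  then obtain cs where cs: "set cs \<subseteq> W" "fold transv cs u = u'" using transitive assms by blast
  have "sform u' (fold transv cs v) = 1" using cs assms fold_transv_sform[of cs u v] by simp
  then obtain ds where ds: "set ds \<subseteq> W" "fold transv ds u' = u'" "fold transv ds (fold transv cs v) = v'"
    using transitive_stabilizer[of u' "fold transv cs v" v'] assms cs fold_transv_closed by blast
  show ?thesis by (rule exI[of _ "cs @ ds"]) (use cs ds in auto)
qed

end

interpretation whole: symp_space UNIV
  using sform_nondegenerate by unfold_locales auto

text \<open>This is the orthogonal complement of the hyperbolic plane spanned by
  \<open>axis 0 1\<close> and \<open>axis 2 1\<close>.\<close>

lemma symp_space_complement: "symp_space {v. v$0 = 0 \<and> v$2 = 0}"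
proof
  fix u :: "3^4" assume u: "u \<in> {v. v$0 = 0 \<and> v$2 = 0}" "u \<noteq> 0"
  then consider "u$1 \<noteq> 0" | "u$3 \<noteq> 0" by (auto simp: vec4_eq_iff)
  then show "\<exists>y\<in>{v. v$0 = 0 \<and> v$2 = 0}. sform u y \<noteq> 0"
  proof cases
    case 1 then show ?thesis
      by (intro bexI[of _ "axis 3 1"]) (auto simp: sform_axis, auto simp: axis_def)
  next
    case 2 then show ?thesis
      by (intro bexI[of _ "axis 1 1"]) (auto simp: sform_axis, auto simp: axis_def)
  qed
qed auto

text \<open>Transvections first restore one hyperbolic pair; what remains preserves its complement,
  and transvections centred there restore a second pair without disturbing the first. The resulting
  product undoes \<open>f\<close>, so it represents the inverse of \<open>f\<close>.\<close>

lemma symp_isometry_is_transv_prod: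
  fixes f :: "3^4 \<Rightarrow> 3^4"
  assumes sform: "\<And>u v. sform (f u) (f v) = sform u v" 
    and add: "\<And>u v. f (u + v) = f u + f v"
  shows "\<exists>cs. \<forall>v. fold transv cs (f v) = v"
proof -
  let ?e = "\<lambda>i. axis i 1 :: 3^4"
  have "sform (?e 0) (?e 2) = 1" by (simp add: sform_def axis_def)
  then obtain cs where cs: "fold transv cs (f (?e 0)) = ?e 0" "fold transv cs (f (?e 2)) = ?e 2"
    using whole.transitive_hyperbolic[of "f (?e 0)" "f (?e 2)" "?e 0" "?e 2"] by (auto simp: sform)
  let ?W = "{v::3^4. v$0 = 0 \<and> v$2 = 0}"
  interpret W: symp_space ?W by (rule symp_space_complement)
  define g where "g v = fold transv cs (f v)" for v
  have g_sform: "sform (g u) (g v) = sform u v" for u v by (simp add: g_def sform)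
  have W: "g v \<in> ?W" if "v \<in> ?W" for v
    using that g_sform[of v "?e 0"] g_sform[of v "?e 2"] by (simp add: g_def cs sform_axis)
  have e13: "?e 1 \<in> ?W" "?e 3 \<in> ?W" "sform (?e 1) (?e 3) = 1" by (auto simp: sform_axis) (auto simp: axis_def)
  obtain ds where ds: "set ds \<subseteq> ?W" "fold transv ds (g (?e 1)) = ?e 1" "fold transv ds (g (?e 3)) = ?e 3"
    using W.transitive_hyperbolic[OF W W, of "?e 1" "?e 3" "?e 1" "?e 3"] e13 g_sform by auto
  define h where "h v = fold transv ds (g v)" for v
  have "sform (?e i) c = 0" if "c \<in> ?W" "i = 0 \<or> i = 2" for c i
    using that sform_swap[of "?e i" c] by (auto simp: sform_axis)
  then have fixes_e: "fold transv ds (?e i) = ?e i" if "i = 0 \<or> i = 2" for i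
    using that ds(1) by (intro fold_transv_fix) blast
  have h_e: "h (?e i) = ?e i" for i
    using ix4_cases[of i] ds cs fixes_e by (auto simp: h_def g_def)
  have h_sform: "sform (h u) (h v) = sform u v" for u v by (simp add: h_def g_sform)
  have "h v = v" for v
  proof -
    \<comment> \<open>An isometry that fixes the basis keeps the pairings with it, and these are the
      coordinates up to sign and order.\<close>
    have "sform (h v) (?e i) = sform v (?e i)" for i using h_sform[of v "?e i"] by (simp add: h_e)
    from this[of 0] this[of 1] this[of 2] this[of 3]
    show ?thesis by (simp add: sform_axis vec4_eq_iff)
  qed
  then show ?thesis by (intro exI[of _ "cs @ ds"]) (simp add: h_def g_def)
qed


subsection \<open>The symplectic group\<close>

definition dot :: "3^4 \<Rightarrow> 3^4 \<Rightarrow> 3" where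
  "dot u w = (\<Sum>i\<in>UNIV. u$i * w$i)"

lemma sform_eq_dot: "sform u v = dot u (sympJ *v v)"
  by (simp add: sform_def dot_def sympJ_def matrix_vector_mult_def sum_ix4 algebra_simps)

lemma dot_matrix_left: "dot (A *v u) w = dot u (transpose A *v w)"
  unfolding dot_def matrix_vector_mult_def transpose_def
  by (simp add: sum_distrib_left sum_distrib_right) (subst sum.swap, simp add: ac_simps)

lemma dot_axis: "dot (axis i 1) w = w$i"
  by (simp add: dot_def axis_def if_distrib if_distribR cong: if_cong)

lemma dot_eqI: "(\<And>u. dot u w = dot u w') \<Longrightarrow> w = w'"
  by (metis dot_axis vec_eq_iff)

lemma Sp43_iff: "A \<in> carrier Sp43 \<longleftrightarrow> (\<forall>u v. sform (A *v u) (A *v v) = sform u v)"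
proof -
  have "sform (A *v u) (A *v v) = dot u ((transpose A ** sympJ ** A) *v v)" for u v
    by (simp add: sform_eq_dot dot_matrix_left matrix_vector_mul_assoc matrix_mul_assoc)
  then have "(\<forall>u v. sform (A *v u) (A *v v) = sform u v) \<longleftrightarrow>
      (\<forall>v. (transpose A ** sympJ ** A) *v v = sympJ *v v)"
    by (metis dot_eqI sform_eq_dot)
  then show ?thesis by (simp add: Sp43_def matrix_eq)
qed

lemma sympJ_square: "sympJ ** sympJ = - mat 1"
  by (simp add: vec_eq_iff all_ix4 matrix_matrix_mult_def sum_ix4 sympJ_def mat_def)

lemma matrix_minus_vector [simp]: "(- A) *v (v::3^4) = - (A *v v)" for A :: "3^4^4"
  by (simp add: vec_eq_iff matrix_vector_mult_def sum_negf)

lemma matrix_vector_minus [simp]: "A *v (- (v::3^4)) = - (A *v v)" for A :: "3^4^4"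
  by (simp add: vec_eq_iff matrix_vector_mult_def sum_negf)

lemma matrix_vector_add: "A *v (u + v) = A *v u + A *v v" for A :: "3^4^4"
  by (simp add: vec_eq_iff matrix_vector_mult_def sum.distrib distrib_left)

lemma Sp43_left_inverse:
  assumes "A \<in> carrier Sp43"
  obtains B where "B \<in> carrier Sp43" "B ** A = mat 1"
proof -
  \<comment> \<open>\<open>transpose A ** sympJ ** A = sympJ\<close> and \<open>sympJ_square\<close>
    make this a left inverse.\<close>
  define B where "B = - sympJ ** (transpose A ** sympJ)"
  have BA: "B *v (A *v v) = v" for v
  proof -
    have "(transpose A ** sympJ) *v (A *v v) = sympJ *v v"
      using assms by (simp add: Sp43_def matrix_vector_mul_assoc)
    then have "B *v (A *v v) = - (sympJ *v (sympJ *v v))"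
      by (simp add: B_def flip: matrix_vector_mul_assoc)
    then show ?thesis by (simp add: matrix_vector_mul_assoc sympJ_square)
  qed
  then have "inj ((*v) A)" by (metis injI)
  then have "surj ((*v) A)" by (simp add: finite_UNIV_inj_surj)
  \<comment> \<open>As every vector is an image under \<open>A\<close>, the isometry property passes
    from \<open>A\<close> to \<open>B\<close>.\<close>
  then have "\<exists>u'. u = A *v u'" for u by (metis surjD)
  then have "B \<in> carrier Sp43" using assms BA unfolding Sp43_iff by metis
  moreover have "B ** A = mat 1" using BA by (simp add: matrix_eq flip: matrix_vector_mul_assoc)
  ultimately show ?thesis using that by blast
qed

lemma mat_1_in_Sp43: "mat 1 \<in> carrier Sp43"
  by (simp add: Sp43_iff)

lemma minus_mat_1_in_Sp43: "- mat 1 \<in> carrier Sp43"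
  by (simp add: Sp43_iff)

lemma mult_in_Sp43: "A \<in> carrier Sp43 \<Longrightarrow> B \<in> carrier Sp43 \<Longrightarrow> A ** B \<in> carrier Sp43"
  by (simp add: Sp43_iff flip: matrix_vector_mul_assoc)

lemma Sp43_mult: "A \<otimes>\<^bsub>Sp43\<^esub> B = A ** B" and Sp43_one: "\<one>\<^bsub>Sp43\<^esub> = mat 1"
  by (simp_all add: Sp43_def)

lemma group_Sp43: "group Sp43"
  by (rule groupI)
    (auto simp: Sp43_mult Sp43_one mult_in_Sp43 mat_1_in_Sp43 matrix_mul_assoc elim: Sp43_left_inverse)

text \<open>The identity plus the outer product of \<open>c\<close> and \<open>sympJ *v c\<close>,
  because \<open>sform v c\<close> is the dot product of \<open>v\<close> with
  \<open>sympJ *v c\<close>.\<close>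

definition transv_mat :: "3^4 \<Rightarrow> 3^4^4" where
  "transv_mat c = (\<chi> i j. (if i = j then 1 else 0) + c$i * (sympJ *v c)$j)"

lemma transv_mat: "transv_mat c *v v = transv c v"
proof -
  have "(transv_mat c *v v)$i = v$i + c$i * dot v (sympJ *v c)" for i
  proof -
    have "(transv_mat c)$i$j * v$j = (if i = j then v$j else 0) + c$i * (v$j * (sympJ *v c)$j)" for j
      by (simp add: transv_mat_def algebra_simps)
    then show ?thesis
      by (simp add: matrix_vector_mult_def[of "transv_mat c"] dot_def sum.distrib sum_distrib_left)
  qed
  then show ?thesis by (simp add: vec_eq_iff transv_def sform_eq_dot mult.commute)
qed

lemma transv_mat_in_Sp43: "transv_mat c \<in> carrier Sp43"
  by (simp add: Sp43_iff transv_mat)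

lemma Sp43_nonzero: "A \<in> carrier Sp43 \<Longrightarrow> A *v v = 0 \<longleftrightarrow> v = 0"
  by (metis Sp43_iff matrix_vector_mult_0_right sform_nondegenerate sform_simps(10))

text \<open>One sign must serve for all vectors: if a nonzero \<open>u\<close> is negated and a
  nonzero \<open>w\<close> is fixed, then \<open>u + w\<close> goes to \<open>w - u\<close>, which
  is neither \<open>u + w\<close> nor its negative.\<close>

lemma Sp43_projective_kernel:
  assumes A: "A \<in> carrier Sp43" and lines: "\<And>v. A *v v = v \<or> A *v v = - v"
  shows "A = mat 1 \<or> A = - mat 1"
proof (rule ccontr)
  assume "\<not> (A = mat 1 \<or> A = - mat 1)"
  then obtain u w where "A *v u \<noteq> u" "A *v w \<noteq> - w" by (auto simp: matrix_eq)
  then have u: "A *v u = - u" "u \<noteq> - u" and w: "A *v w = w" "w \<noteq> - w" using lines by metis+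
  have "A *v (u + w) = - u + w" using u w by (simp add: matrix_vector_add)
  with lines[of "u + w"] have "- u + w = u + w \<or> - u + w = - u + - w" by (metis minus_add_distrib)
  then show False using u(2) w(2) by (metis add_left_cancel add_right_cancel)
qed

section \<open>Labels of the orbit points\<close>

definition vec4 :: "int \<times> int \<times> int \<times> int \<Rightarrow> 3^4" where
  "vec4 q = (case q of (a,b,c,d) \<Rightarrow>
     \<chi> i. of_int (if i = 0 then a else if i = 1 then b else if i = 2 then c else d))"

lemma vec4_nth [simp]:
  "vec4 (a,b,c,d) $ 0 = of_int a" "vec4 (a,b,c,d) $ 1 = of_int b"
  "vec4 (a,b,c,d) $ 2 = of_int c" "vec4 (a,b,c,d) $ 3 = of_int d"
  by (simp_all add: vec4_def)

lemma of_int_bal: "(of_int (bal x) :: 3) = of_int x"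
proof -
  have "bal x = x - 3 * ((x + 1) div 3)"
    using mult_div_mod_eq[of 3 "x + 1"] unfolding bal_def by linarith
  then show ?thesis by (simp only: of_int_diff of_int_mult of_int_numeral F3_times_three diff_zero)
qed

lemma sform_vec4: "sform (vec4 u) (vec4 v) = of_int (form4 u v)"
  by (cases u; cases v) (simp add: sform_def form4_def)

lemma transv_vec4: "transv (vec4 c) (vec4 v) = vec4 (transv4 c v)"
  by (cases c; cases v)
    (simp add: transv_def sform_vec4 vec4_eq_iff transv4_def Let_def of_int_bal)

lemma vec4_neg4: "vec4 (neg4 q) = - vec4 q"
  by (cases q) (simp add: vec4_eq_iff neg4_def)

lemma F3_of_int_cases: "\<exists>a\<in>set [-1,0,1]. (x::3) = of_int a"
  using F3_cases[of x] by auto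

lemma vec4_surj:
  "\<exists>a\<in>set [-1,0,1]. \<exists>b\<in>set [-1,0,1]. \<exists>c\<in>set [-1,0,1]. \<exists>d\<in>set [-1,0,1]. v = vec4 (a,b,c,d)"
proof -
  obtain a b c d where "a\<in>set [-1,0,1]" "v$0 = of_int a" "b\<in>set [-1,0,1]" "v$1 = of_int b"
    "c\<in>set [-1,0,1]" "v$2 = of_int c" "d\<in>set [-1,0,1]" "v$3 = of_int d"
    using F3_of_int_cases[of "v$0"] F3_of_int_cases[of "v$1"] F3_of_int_cases[of "v$2"]
      F3_of_int_cases[of "v$3"] by blast
  then show ?thesis by (intro bexI[of _ a] bexI[of _ b] bexI[of _ c] bexI[of _ d]) (simp_all only: vec4_eq_iff vec4_nth)
qed

lemma of_int_F3_inj: "a \<in> set [-1,0,1] \<Longrightarrow> b \<in> set [-1,0,1] \<Longrightarrow> (of_int a :: 3) = of_int b \<Longrightarrow> a = b"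
  by auto

definition label :: "nat \<Rightarrow> 3^4" where
  "label k = vec4 (label_table ! k)"

definition centre :: "nat \<Rightarrow> 3^4" where
  "centre i = vec4 (centre4 i)"

lemma label_cover:
  assumes "v \<noteq> 0"
  obtains k where "k < 40" "v = label k \<or> v = - label k"
proof -
  obtain a b c d where abcd: "a\<in>set [-1,0,1]" "b\<in>set [-1,0,1]" "c\<in>set [-1,0,1]" "d\<in>set [-1,0,1]"
    and v: "v = vec4 (a,b,c,d)" using vec4_surj[of v] by blast
  have "(a,b,c,d) \<noteq> (0,0,0,0)" using assms v by (auto simp: vec4_eq_iff)
  then have "(a,b,c,d) \<in> set label_table \<or> (a,b,c,d) \<in> neg4 ` set label_table"
  proof -
    have "(a,b,c,d) \<in> set label_table \<union> neg4 ` set label_table"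
      using label_table_cover[THEN bspec, OF abcd(1), THEN bspec, OF abcd(2), THEN bspec, OF abcd(3), THEN bspec, OF abcd(4)]
        \<open>(a,b,c,d) \<noteq> (0,0,0,0)\<close> unfolding set_append set_map by blast
    then show ?thesis by (rule UnE) simp_all
  qed
  then obtain q where "q \<in> set label_table" "(a,b,c,d) = q \<or> (a,b,c,d) = neg4 q" by blast
  then obtain k where "k < 40" "(a,b,c,d) = label_table ! k \<or> (a,b,c,d) = neg4 (label_table ! k)"
    by (metis in_set_conv_nth length_label_table)
  then show ?thesis using that v vec4_neg4 unfolding label_def by metis
qed

lemma label_unique:
  assumes "k < 40" "l < 40"
  shows "label k = label l \<longleftrightarrow> k = l" "label k \<noteq> - label l"
proof -
  have inj: "q = q'" if "vec4 q = vec4 q'" and qq: "q \<in> set label_table \<or> q \<in> neg4 ` set label_table"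
    "q' \<in> set label_table \<or> q' \<in> neg4 ` set label_table" for q q'
  proof -
    obtain a b c d a' b' c' d' where q: "q = (a,b,c,d)" "q' = (a',b',c',d')" by (metis prod_cases4)
    have digits: "a \<in> set [-1,0,1] \<and> b \<in> set [-1,0,1] \<and> c \<in> set [-1,0,1] \<and> d \<in> set [-1,0,1]"
      if "(a,b,c,d) \<in> set label_table \<or> (a,b,c,d) \<in> neg4 ` set label_table" for a b c d
      using that
    proof
      assume "(a,b,c,d) \<in> set label_table"
      from bspec[OF label_table_range this] show ?thesis by simp
    next
      assume "(a,b,c,d) \<in> neg4 ` set label_table"
      then obtain x where x: "x \<in> set label_table" "(a,b,c,d) = neg4 x" by blast
      obtain a' b' c' d' where x': "x = (a',b',c',d')" by (metis prod_cases4)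
      have "a = - a'" "b = - b'" "c = - c'" "d = - d'" using x x' by (simp_all add: neg4_def)
      with bspec[OF label_table_range x(1)] show ?thesis unfolding x' by auto
    qed
    have eqs: "(of_int a :: 3) = of_int a'" "(of_int b :: 3) = of_int b'"
      "(of_int c :: 3) = of_int c'" "(of_int d :: 3) = of_int d'"
      using that(1) unfolding q vec4_eq_iff vec4_nth by blast+
    have "a = a'" "b = b'" "c = c'" "d = d'"
      using digits[OF qq(1)[unfolded q]] digits[OF qq(2)[unfolded q]] eqs
      by (simp_all only: of_int_F3_inj)
    then show ?thesis unfolding q by simp
  qed
  have mem: "label_table ! k \<in> set label_table" "label_table ! l \<in> set label_table"
    using assms length_label_table by auto
  have d: "distinct label_table" "set label_table \<inter> neg4 ` set label_table = {}"
    using label_table_distinct unfolding distinct_append by auto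
  show "label k = label l \<longleftrightarrow> k = l"
    using inj[of "label_table ! k" "label_table ! l"] mem d(1) assms
    by (auto simp: label_def nth_eq_iff_index_eq length_label_table)
  show "label k \<noteq> - label l"
  proof
    assume "label k = - label l"
    then have "label_table ! k = neg4 (label_table ! l)"
      using inj[of "label_table ! k" "neg4 (label_table ! l)"] mem by (simp add: label_def vec4_neg4)
    then have "label_table ! k \<in> set label_table \<inter> neg4 ` set label_table" using mem by simp
    then show False unfolding d(2) by simp
  qed
qed

lemma label_nonzero: "k < 40 \<Longrightarrow> label k \<noteq> 0"
  using label_unique(2)[of k k] by auto

text \<open>The number of the line through \<open>v\<close>, unique by \<open>label_unique\<close>.
  At 0 the value is unspecified, whence the conditions \<open>v \<noteq> 0\<close> from here
  on.\<close>

definition index :: "3^4 \<Rightarrow> nat" where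
  "index v = (SOME k. k < 40 \<and> (v = label k \<or> v = - label k))"

lemma index:
  assumes "v \<noteq> 0"
  shows "index v < 40" "v = label (index v) \<or> v = - label (index v)"
  using someI_ex[of "\<lambda>k. k < 40 \<and> (v = label k \<or> v = - label k)"] label_cover[OF assms]
  unfolding index_def by metis+

lemma index_eqI: "k < 40 \<Longrightarrow> v = label k \<or> v = - label k \<Longrightarrow> index v = k"
proof -
  assume k: "k < 40" "v = label k \<or> v = - label k"
  then have "v \<noteq> 0" using label_nonzero by auto
  note i = index[OF this]
  consider "label (index v) = label k" | "label (index v) = - label k" | "- label (index v) = label k"
    using i(2) k(2) by (metis minus_minus)
  then show ?thesis
    using label_unique[OF i(1) k(1)] label_unique[OF k(1) i(1)] by cases auto
qed

lemma index_label [simp]: "k < 40 \<Longrightarrow> index (label k) = k"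
  by (simp add: index_eqI)

lemma index_minus [simp]: "v \<noteq> 0 \<Longrightarrow> index (- v) = index v"
proof (rule index_eqI)
  assume v: "v \<noteq> 0"
  show "index v < 40" by (rule index(1)[OF v])
  show "- v = label (index v) \<or> - v = - label (index v)" using index(2)[OF v] by (metis minus_minus)
qed

lemma index_eq_iff: "u \<noteq> 0 \<Longrightarrow> v \<noteq> 0 \<Longrightarrow> index u = index v \<longleftrightarrow> u = v \<or> u = - v"
proof
  assume uv: "u \<noteq> 0" "v \<noteq> 0" "index u = index v"
  show "u = v \<or> u = - v" using index(2)[OF uv(1)] index(2)[OF uv(2)] unfolding uv(3) by (metis minus_minus)
qed auto

lemma letter_index: "i \<in> {2..6} \<longleftrightarrow> i \<in> set [2,3,4,5,6::nat]"
  by auto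

lemma target_lt: "i \<in> {2..6} \<Longrightarrow> k < 40 \<Longrightarrow> target i k < 40"
  and target_target_target: "i \<in> {2..6} \<Longrightarrow> k < 40 \<Longrightarrow> target i (target i (target i k)) = k"
proof -
  assume ik: "i \<in> {2..6}" "k < 40"
  have "i \<in> set [2,3,4,5,6]" "k \<in> set [0..<40]" using ik letter_index by simp_all
  from bspec[OF bspec[OF target_cube this(1)] this(2)]
  show "target i k < 40" "target i (target i (target i k)) = k" by blast+
qed

lemma transv_label:
  assumes "i \<in> {2..6}" "k < 40"
  shows "transv (centre i) (label k) \<in> {label (target i k), - label (target i k)}"
proof -
  have "i \<in> set [2,3,4,5,6]" "k \<in> set [0..<40]" using assms letter_index by simp_all
  from bspec[OF bspec[OF transv_table this(1)] this(2)]
  show ?thesis unfolding label_def centre_def transv_vec4 vec4_neg4[symmetric] insert_iff empty_iff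
    by (elim disjE) simp_all
qed

lemma index_transv:
  assumes "i \<in> {2..6}" "v \<noteq> 0"
  shows "index (transv (centre i) v) = target i (index v)"
proof (rule index_eqI)
  show "target i (index v) < 40" using assms index(1) target_lt by blast
  have "transv (centre i) v = transv (centre i) (label (index v)) \<or>
      transv (centre i) v = - transv (centre i) (label (index v))"
    using index(2)[OF assms(2)] transv_minus(2) by metis
  then show "transv (centre i) v = label (target i (index v)) \<or>
      transv (centre i) v = - label (target i (index v))"
    using transv_label[OF assms(1) index(1)[OF assms(2)]] by auto
qed

lemma label_0: "label 0 = centre 2"
  by (simp add: label_def centre_def label_table_def centre4_def)

definition base_index :: nat where "base_index = 33"

lemma base_index_lt [simp]: "base_index < 40"
  by (simp add: base_index_def)

lemma tuple_table_base: "tuple_table ! base_index = [wa, wb, wa, wa, wb, wa]"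
  by code_simp

lemma form4_base: "form4 (label_table ! base_index) (centre4 2) = -1"
  by code_simp

lemma sform_base: "sform (label base_index) (centre 2) = -1"
  by (simp add: label_def centre_def sform_vec4 form4_base)

lemma parent:
  assumes "0 < k" "k < 40"
  obtains i l where "i \<in> {2..6}" "l < k" "target i l = k"
proof -
  have "k \<in> set [1..<40]" using assms by simp
  from bspec[OF parent_table this] obtain i l
    where "i \<in> set [2,3,4,5,6]" "l \<in> set [0..<k]" "target i l = k" by blast
  then show ?thesis using that letter_index by simp
qed

section \<open>Cycle types of permutations of order three\<close>

text \<open>Since the cube of \<open>f\<close> is the identity, cycles have one or three elements,
  and the 3-cycles partition the \<open>3 * q\<close> moved points.\<close>

lemma cycle_type_order_3:
  assumes "finite Z" and Z: "\<And>x. x \<in> Z \<Longrightarrow> f x \<in> Z" and f3: "\<And>x. x \<in> Z \<Longrightarrow> f (f (f x)) = x"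
    and "card {x \<in> Z. f x = x} = p" and "card Z = p + 3 * q"
  shows "cycle_type f Z = replicate_mset p 1 + replicate_mset q 3"
proof -
  define cyc where "cyc x = {x, f x, f (f x)}" for x
  have orbit: "{(f ^^ n) x | n. True} = cyc x" if "x \<in> Z" for x
  proof -
    have "(f ^^ n) x \<in> cyc x" for n
      by (induction n) (auto simp: cyc_def f3[OF that])
    moreover have "\<exists>n. y = (f ^^ n) x" if "y \<in> cyc x" for y
    proof -
      have "y = (f ^^ 0) x \<or> y = (f ^^ 1) x \<or> y = (f ^^ 2) x"
        using that by (simp add: cyc_def numeral_2_eq_2)
      then show ?thesis by metis
    qed
    ultimately show ?thesis by auto
  qed
  then have cycles: "cycles_on f Z = cyc ` Z" by (simp add: cycles_on_def)
  define F where "F = {x \<in> Z. f x = x}"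
  define M where "M = Z - F"
  have fin: "finite F" "finite M" using assms(1) by (auto simp: F_def M_def)
  have F: "cyc x = {x}" if "x \<in> F" for x using that by (simp add: F_def cyc_def)
  have M: "card (cyc x) = 3" "cyc x \<subseteq> M" if "x \<in> M" for x
  proof -
    have x: "x \<in> Z" "f x \<noteq> x" using that by (auto simp: F_def M_def)
    have ne: "f (f x) \<noteq> f x" "f (f x) \<noteq> x" using x(2) f3[OF x(1)] by auto
    then show "card (cyc x) = 3" using x(2) by (simp add: cyc_def)
    have "f x \<in> Z" "f (f x) \<in> Z" "f (f (f x)) \<noteq> f (f x)" using x(1) Z f3[OF x(1)] ne(2) by auto
    then show "cyc x \<subseteq> M" using x ne(1) by (simp add: cyc_def M_def F_def)
  qed
  have cyc_f: "cyc (f z) = cyc z" if "z \<in> Z" for z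
    by (simp add: cyc_def f3[OF that] insert_commute)
  have cyc_eq: "cyc w = cyc z" if "w \<in> cyc z" "z \<in> Z" for w z
  proof -
    have "w = z \<or> w = f z \<or> w = f (f z)" using that(1) by (simp add: cyc_def)
    then show ?thesis using cyc_f[OF that(2)] cyc_f[OF Z[OF that(2)]] by (elim disjE) simp_all
  qed
  have disj: "cyc x = cyc y" if xy: "x \<in> Z" "y \<in> Z" "cyc x \<inter> cyc y \<noteq> {}" for x y
  proof -
    obtain w where w: "w \<in> cyc x" "w \<in> cyc y" using xy(3) by blast
    show ?thesis using cyc_eq[OF w(1) xy(1)] cyc_eq[OF w(2) xy(2)] by simp
  qed
  have "x \<in> cyc x" for x by (simp add: cyc_def)
  then have un: "\<Union> (cyc ` M) = M" using M(2) by blast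
  have "card M = card (cyc ` M) * 3"
  proof -
    have "3 * card (cyc ` M) = card (\<Union> (cyc ` M))"
    proof (rule card_partition)
      show "finite (cyc ` M)" "finite (\<Union> (cyc ` M))" using fin un by simp_all
      show "card c = 3" if "c \<in> cyc ` M" for c using that M by blast
      show "c \<inter> d = {}" if "c \<in> cyc ` M" "d \<in> cyc ` M" "c \<noteq> d" for c d
      proof -
        from that obtain x y where "x \<in> Z" "y \<in> Z" "c = cyc x" "d = cyc y" by (auto simp: M_def)
        then show ?thesis using that(3) disj[of x y] by argo
      qed
    qed
    then show ?thesis unfolding un by simp
  qed
  moreover have "card M = 3 * q"
    using assms card_Diff_subset[of F Z] fin by (simp add: M_def F_def)
  ultimately have q: "card (cyc ` M) = q" by simp
  have p: "card (cyc ` F) = p"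
    using assms(4) F by (subst card_image) (auto simp: inj_on_def F_def)
  have "cyc ` Z = cyc ` F \<union> cyc ` M" by (auto simp: M_def F_def)
  moreover have "cyc ` F \<inter> cyc ` M = {}"
  proof -
    have "card c = 1" if "c \<in> cyc ` F" for c using that F by auto
    moreover have "card c = 3" if "c \<in> cyc ` M" for c using that M by blast
    ultimately show ?thesis by fastforce
  qed
  ultimately have "mset_set (cycles_on f Z) = mset_set (cyc ` F) + mset_set (cyc ` M)"
    using fin by (simp add: cycles mset_set_Union)
  moreover have "image_mset card (mset_set (cyc ` F)) = image_mset (\<lambda>_. 1) (mset_set (cyc ` F))"
    using F fin by (intro image_mset_cong) auto
  moreover have "image_mset card (mset_set (cyc ` M)) = image_mset (\<lambda>_. 3) (mset_set (cyc ` M))"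
    using M fin by (intro image_mset_cong) auto
  ultimately show ?thesis
    by (simp only: cycle_type_def image_mset_union image_mset_const_eq size_mset_set p q)
qed

section \<open>The Hurwitz action on tuples\<close>

text \<open>Braid indices count places from 1 and lists from 0, so \<open>beta_i\<close> touches the
  entries \<open>i - 2\<close> and \<open>i - 1\<close>; splitting the list there removes the index
  arithmetic.\<close>

lemma hur_tup_split:
  assumes "i \<ge> 2" "length ps = i - 2"
  shows "hur_tup G i (ps @ x # y # qs) = ps @ conjg G x y # x # qs"
    "hur_tup_inv G i (ps @ x # y # qs) = ps @ y # conjg G (inv\<^bsub>G\<^esub> y) x # qs"
proof -
  have i: "i - 1 = Suc (length ps)" "i - 2 = length ps" using assms by auto
  show "hur_tup G i (ps @ x # y # qs) = ps @ conjg G x y # x # qs"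
    "hur_tup_inv G i (ps @ x # y # qs) = ps @ y # conjg G (inv\<^bsub>G\<^esub> y) x # qs"
    unfolding hur_tup_def hur_tup_inv_def i by (simp_all add: nth_append list_update_append)
qed

lemma whur_split:
  assumes "i \<ge> 2" "length ps = i - 2"
  shows "whur i (ps @ x # y # qs) = ps @ wconj x y # x # qs"
proof -
  have i: "i - 1 = Suc (length ps)" "i - 2 = length ps" using assms by auto
  show ?thesis unfolding whur_def i by (simp add: nth_append list_update_append)
qed

lemma split_at_letter:
  assumes "2 \<le> i" "i \<le> length t"
  obtains ps x y qs where "t = ps @ x # y # qs" "length ps = i - 2"
proof -
  have "i - 2 < length t" "Suc (i - 2) < length t" using assms by auto
  then have "t = take (i - 2) t @ t ! (i - 2) # t ! Suc (i - 2) # drop (Suc (Suc (i - 2))) t"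
    by (metis Cons_nth_drop_Suc append_take_drop_id)
  then show ?thesis using assms by (intro that) auto
qed

lemma length_hur_tup [simp]: "length (hur_tup G i t) = length t"
  by (simp add: hur_tup_def)

context group
begin

lemma conjg_closed [simp]: "g \<in> carrier G \<Longrightarrow> x \<in> carrier G \<Longrightarrow> conjg G g x \<in> carrier G"
  by (simp add: conjg_def)

lemma inv_mult_cancel [simp]:
  "x \<in> carrier G \<Longrightarrow> y \<in> carrier G \<Longrightarrow> inv x \<otimes> (x \<otimes> y) = y"
  "x \<in> carrier G \<Longrightarrow> y \<in> carrier G \<Longrightarrow> x \<otimes> (inv x \<otimes> y) = y"
  by (simp_all flip: m_assoc)

lemma conjg_conjg:
  "g \<in> carrier G \<Longrightarrow> h \<in> carrier G \<Longrightarrow> x \<in> carrier G \<Longrightarrow> conjg G g (conjg G h x) = conjg G (g \<otimes> h) x"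
  by (simp add: conjg_def m_assoc inv_mult_group)

lemma conjg_one [simp]: "x \<in> carrier G \<Longrightarrow> conjg G \<one> x = x"
  by (simp add: conjg_def)

lemma conjg_hom:
  "g \<in> carrier G \<Longrightarrow> x \<in> carrier G \<Longrightarrow> y \<in> carrier G \<Longrightarrow>
    conjg G g (conjg G x y) = conjg G (conjg G g x) (conjg G g y)"
  by (simp add: conjg_def m_assoc inv_mult_group)

lemma hur_tup_conjg:
  assumes "2 \<le> i" "i \<le> length t" "set t \<subseteq> carrier G" "g \<in> carrier G"
  shows "hur_tup G i (map (conjg G g) t) = map (conjg G g) (hur_tup G i t)"
proof -
  obtain ps x y qs where t: "t = ps @ x # y # qs" "length ps = i - 2"
    using split_at_letter[OF assms(1,2)] .
  then show ?thesis using assms by (simp add: hur_tup_split flip: conjg_hom)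
qed

lemma hur_tup_inv_hur_tup:
  assumes "2 \<le> i" "i \<le> length t" "set t \<subseteq> carrier G"
  shows "hur_tup_inv G i (hur_tup G i t) = t"
proof -
  obtain ps x y qs where t: "t = ps @ x # y # qs" "length ps = i - 2"
    using split_at_letter[OF assms(1,2)] .
  then show ?thesis using assms by (simp add: hur_tup_split conjg_def m_assoc)
qed

lemma map_conjg_conjg:
  assumes "set t \<subseteq> carrier G" "g \<in> carrier G" "h \<in> carrier G"
  shows "map (conjg G g) (map (conjg G h) t) = map (conjg G (g \<otimes> h)) t"
  using assms by (auto simp: conjg_conjg)

lemma tuple_class_conjg:
  assumes "set t \<subseteq> carrier G" "g \<in> carrier G"
  shows "tuple_class G (map (conjg G g) t) = tuple_class G t"
proof
  show "tuple_class G (map (conjg G g) t) \<subseteq> tuple_class G t"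
    using assms unfolding tuple_class_def by (force simp: map_conjg_conjg simp del: map_map)
  have "map (conjg G h) t \<in> tuple_class G (map (conjg G g) t)" if "h \<in> carrier G" for h
  proof -
    have "map (conjg G h) t = map (conjg G (h \<otimes> inv g)) (map (conjg G g) t)"
      using assms that by (simp add: map_conjg_conjg m_assoc del: map_map)
    then show ?thesis using assms that unfolding tuple_class_def by blast
  qed
  then show "tuple_class G t \<subseteq> tuple_class G (map (conjg G g) t)"
    by (auto simp: tuple_class_def)
qed

lemma mem_tuple_class: "set t \<subseteq> carrier G \<Longrightarrow> t \<in> tuple_class G t"
  unfolding tuple_class_def by (auto intro!: exI[of _ "\<one>"] map_idI[symmetric])

lemma tuple_class_image:
  assumes "\<And>g. g \<in> carrier G \<Longrightarrow> F (map (conjg G g) t) = map (conjg G g) (F t)"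
  shows "F ` tuple_class G t = tuple_class G (F t)"
  using assms unfolding tuple_class_def by (auto simp: image_iff) metis+

text \<open>The inverse letter is evaluated only on images of the forward letter, which it undoes
  tuple by tuple. This covers the orbit, because each index map \<open>target i\<close> is a
  permutation.\<close>

lemma hstep_tuple_class:
  assumes "2 \<le> i" "i \<le> length t" "set t \<subseteq> carrier G"
  shows "hstep G (i, False) (tuple_class G t) = tuple_class G (hur_tup G i t)"
    "hstep G (i, True) (tuple_class G (hur_tup G i t)) = tuple_class G t"
proof -
  show "hstep G (i, False) (tuple_class G t) = tuple_class G (hur_tup G i t)"
    using assms by (auto simp: hstep_def hur_tup_conjg intro!: tuple_class_image)
  have "hur_tup_inv G i ` tuple_class G (hur_tup G i t) = tuple_class G (hur_tup_inv G i (hur_tup G i t))"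
  proof (rule tuple_class_image)
    fix g assume g: "g \<in> carrier G"
    have "set (map (conjg G g) t) \<subseteq> carrier G" using assms(3) g by auto
    then show "hur_tup_inv G i (map (conjg G g) (hur_tup G i t)) =
        map (conjg G g) (hur_tup_inv G i (hur_tup G i t))"
      using assms g hur_tup_conjg[OF assms g] by (metis hur_tup_inv_hur_tup length_map)
  qed
  then show "hstep G (i, True) (tuple_class G (hur_tup G i t)) = tuple_class G t"
    using assms by (simp add: hstep_def hur_tup_inv_hur_tup)
qed

section \<open>Invariance of generating systems under the braid action\<close>

lemma conj_class_closed:
  assumes "s \<in> carrier G" "g \<in> carrier G" "x \<in> conj_class G s"
  shows "conjg G g x \<in> conj_class G s"
proof -
  obtain h where "h \<in> carrier G" "x = conjg G h s" using assms(3) by (auto simp: conj_class_def)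
  then show ?thesis using assms unfolding conj_class_def
    by (auto simp: conjg_conjg intro!: exI[of _ "g \<otimes> h"])
qed

lemma conj_class_carrier: "s \<in> carrier G \<Longrightarrow> conj_class G s \<subseteq> carrier G"
  by (auto simp: conj_class_def)

lemma gen_systems_replicate:
  "t \<in> gen_systems G (replicate m C) \<longleftrightarrow>
    length t = m \<and> set t \<subseteq> C \<and> generate G (set t) = carrier G \<and> tuple_prod G t = \<one>"
  by (auto simp: gen_systems_def in_set_conv_nth subset_iff)

lemma tuple_prod_closed: "set t \<subseteq> carrier G \<Longrightarrow> tuple_prod G t \<in> carrier G"
  by (induction t) (auto simp: tuple_prod_def)

lemma hur_tup_gen_systems:
  assumes "s \<in> carrier G" and t: "t \<in> gen_systems G (replicate m (conj_class G s))"
    and "2 \<le> i" "i \<le> m"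
  shows "hur_tup G i t \<in> gen_systems G (replicate m (conj_class G s))"
proof -
  let ?C = "conj_class G s"
  from t have tm: "length t = m" "set t \<subseteq> ?C" "generate G (set t) = carrier G" "tuple_prod G t = \<one>"
    by (simp_all add: gen_systems_replicate)
  obtain ps x y qs where t_eq: "t = ps @ x # y # qs" "length ps = i - 2"
    using split_at_letter[of i t] assms(3,4) tm(1) by metis
  have C: "?C \<subseteq> carrier G" using assms(1) by (rule conj_class_carrier)
  have xy: "x \<in> carrier G" "y \<in> carrier G" "set qs \<subseteq> carrier G" "set ps \<subseteq> carrier G"
    using tm(2) C t_eq by auto
  have h: "hur_tup G i t = ps @ conjg G x y # x # qs" using t_eq assms by (simp add: hur_tup_split)
  let ?t = "ps @ conjg G x y # x # qs"
  have "set ?t \<subseteq> ?C" using tm(2) t_eq xy(1) assms(1) by (auto simp: conj_class_closed)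
  moreover have "tuple_prod G ?t = tuple_prod G t"
    using xy tuple_prod_closed[of qs] by (simp add: t_eq tuple_prod_def conjg_def m_assoc)
  moreover have "generate G (set ?t) = carrier G"
  proof
    have car: "set ?t \<subseteq> carrier G" using xy by auto
    then show "generate G (set ?t) \<subseteq> carrier G" by (rule generate_incl)
    have sub: "subgroup (generate G (set ?t)) G" using car by (rule generate_is_subgroup)
    have x: "x \<in> generate G (set ?t)" and c: "conjg G x y \<in> generate G (set ?t)"
      by (auto intro: generate.incl)
    \<comment> \<open>The entry \<open>y\<close> that left the tuple is recovered by conjugating
      back with \<open>x\<close>.\<close>
    have "inv x \<otimes> (conjg G x y \<otimes> x) \<in> generate G (set ?t)"
      using sub x c by (simp add: subgroup.m_closed subgroup.m_inv_closed)
    moreover have "inv x \<otimes> (conjg G x y \<otimes> x) = y" using xy by (simp add: conjg_def m_assoc)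
    ultimately have "y \<in> generate G (set ?t)" by simp
    then have "set t \<subseteq> generate G (set ?t)" unfolding t_eq by (auto intro: generate.incl)
    then show "carrier G \<subseteq> generate G (set ?t)"
      using sub generate_subgroup_incl tm(3) by metis
  qed
  ultimately show ?thesis using tm unfolding h by (simp add: gen_systems_replicate t_eq)
qed

end

section \<open>Generation by two braided elements\<close>

locale braided_pair = group G for G (structure) +
  fixes s1 s2 :: 'a
  assumes s1 [simp]: "s1 \<in> carrier G" and s2 [simp]: "s2 \<in> carrier G"
    and generated: "generate G {s1, s2} = carrier G"
    and braid: "s1 \<otimes> s2 \<otimes> s1 = s2 \<otimes> s1 \<otimes> s2"
    and ord_2: "ord (s1 \<otimes> s2 \<otimes> s1) = 2"
begin

text \<open>The homomorphism from the modular group to \<open>G\<close>, given on letters; the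
  relations proved below make it compatible with the reductions of \<open>lmul\<close>.\<close>

fun ev :: "letter \<Rightarrow> 'a" where
  "ev S = s1 \<otimes> s2 \<otimes> s1"
| "ev T = s1 \<otimes> s2"
| "ev U = s1 \<otimes> s2 \<otimes> (s1 \<otimes> s2)"

definition evw :: "letter list \<Rightarrow> 'a" where
  "evw w = foldr (\<lambda>x y. ev x \<otimes> y) w \<one>"

lemma ev_closed [simp]: "ev x \<in> carrier G"
  by (cases x) auto

lemma evw_simps [simp]: "evw [] = \<one>" "evw (x # w) = ev x \<otimes> evw w"
  by (simp_all add: evw_def)

lemma evw_closed [simp]: "evw w \<in> carrier G"
  by (induction w) auto

lemma ev_S_S: "ev S \<otimes> ev S = \<one>"
proof -
  have "ev S [^] (2::nat) = \<one>" using pow_ord_eq_1[of "ev S"] ord_2 by simp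
  then show ?thesis by (simp add: numeral_2_eq_2)
qed

lemma ev_T_T: "ev T \<otimes> ev T = ev U"
  by simp

text \<open>By the braid relation the cube of \<open>s1 s2\<close> equals the square of
  \<open>s1 s2 s1\<close>.\<close>

lemma ev_T_U: "ev T \<otimes> ev U = \<one>"
proof -
  have "ev T \<otimes> ev U = (s1 \<otimes> s2 \<otimes> s1) \<otimes> (s2 \<otimes> s1 \<otimes> s2)" by (simp add: m_assoc)
  also have "\<dots> = ev S \<otimes> ev S" unfolding braid[symmetric] by simp
  finally show ?thesis by (simp only: ev_S_S)
qed

lemma ev_U_T: "ev U \<otimes> ev T = \<one>"
  using ev_T_U ev_closed inv_comm by blast

lemma ev_U_U: "ev U \<otimes> ev U = ev T"
proof -
  have "ev U \<otimes> ev U = ev T \<otimes> ev T \<otimes> ev U" by (simp only: ev_T_T)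
  also have "\<dots> = ev T" using ev_T_U ev_closed m_assoc r_one by metis
  finally show ?thesis .
qed

lemmas ev_mult = ev_S_S ev_T_T ev_T_U ev_U_T ev_U_U

lemma ev_mult_left:
  "y \<in> carrier G \<Longrightarrow> ev S \<otimes> (ev S \<otimes> y) = y"
  "y \<in> carrier G \<Longrightarrow> ev T \<otimes> (ev T \<otimes> y) = ev U \<otimes> y"
  "y \<in> carrier G \<Longrightarrow> ev T \<otimes> (ev U \<otimes> y) = y"
  "y \<in> carrier G \<Longrightarrow> ev U \<otimes> (ev T \<otimes> y) = y"
  "y \<in> carrier G \<Longrightarrow> ev U \<otimes> (ev U \<otimes> y) = ev T \<otimes> y"
  by (simp_all only: m_assoc[OF ev_closed ev_closed, symmetric] ev_mult l_one)

lemma evw_lmul: "evw (lmul x w) = ev x \<otimes> evw w"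
  by (cases "(x, w)" rule: lmul.cases) (simp_all add: ev_mult_left del: ev.simps)

lemma evw_wmul: "evw (wmul u w) = evw u \<otimes> evw w"
  by (induction u) (simp_all add: wmul_def evw_lmul m_assoc del: ev.simps)

lemma evw_append: "evw (u @ w) = evw u \<otimes> evw w"
  by (induction u) (simp_all add: m_assoc del: ev.simps)

lemma ev_linv: "ev (linv x) = inv (ev x)"
  by (cases x) (metis linv.simps ev_mult ev_closed inv_equality)+

lemma evw_winv: "evw (winv w) = inv (evw w)"
proof (induction w)
  case (Cons x w)
  then show ?case by (simp add: winv_def evw_append ev_linv inv_mult_group del: ev.simps)
qed (simp add: winv_def)

lemma evw_wconj: "evw (wconj g x) = conjg G (evw g) (evw x)"
  by (simp add: wconj_def conjg_def evw_wmul evw_winv)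

lemma evw_wa: "evw wa = s1"
proof -
  have "ev U \<otimes> ev S = ev U \<otimes> (ev T \<otimes> s1)" by simp
  also have "\<dots> = s1" by (simp only: ev_mult_left s1)
  finally show ?thesis by (simp add: wa_def del: ev.simps)
qed

lemma evw_wb: "evw wb = s2"
proof -
  have "ev S \<otimes> ev U = s2 \<otimes> (ev T \<otimes> ev U)" using braid by (simp add: m_assoc)
  then show ?thesis by (simp only: wb_def evw_simps ev_T_U r_one s2 ev_closed)
qed

lemma hur_tup_evw:
  assumes "2 \<le> i" "i \<le> length t"
  shows "hur_tup G i (map evw t) = map evw (whur i t)"
proof -
  obtain ps x y qs where t: "t = ps @ x # y # qs" "length ps = i - 2"
    using split_at_letter[OF assms(1,2)] .
  then show ?thesis using assms by (simp add: hur_tup_split whur_split evw_wconj)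
qed

definition cls :: "nat \<Rightarrow> 'a list set" where
  "cls k = tuple_class G (map evw (tuple_table ! k))"

text \<open>When \<open>whur_table\<close> is evaluated in \<open>G\<close>, the conjugating word
  disappears in the simultaneous conjugacy class. Different indices might still name one class here;
  \<open>inj_cls\<close> excludes this later by means of the trivial centre.\<close>

lemma hstep_cls:
  assumes "i \<in> {2..6}" "k < 40"
  shows "hstep G (i, False) (cls k) = cls (target i k)" "hstep G (i, True) (cls (target i k)) = cls k"
proof -
  have ik: "i \<in> set [2,3,4,5,6]" "k \<in> set [0..<40]" using assms letter_index by simp_all
  have len: "length (tuple_table ! k) = 6" using length_table ik(2) by blast
  let ?t = "map evw (tuple_table ! k)"
  have t: "2 \<le> i" "i \<le> length ?t" "set ?t \<subseteq> carrier G" using assms len by auto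
  have "hur_tup G i ?t = map evw (whur i (tuple_table ! k))" using t by (intro hur_tup_evw) auto
  also have "whur i (tuple_table ! k) = map (wconj (conjugator i k)) (tuple_table ! target i k)"
    by (rule bspec[OF bspec[OF whur_table ik(1)] ik(2)])
  finally have "hur_tup G i ?t = map (conjg G (evw (conjugator i k))) (map evw (tuple_table ! target i k))"
    by (simp add: evw_wconj)
  then have "tuple_class G (hur_tup G i ?t) = cls (target i k)"
    unfolding cls_def by (simp only:) (rule tuple_class_conjg, auto)
  with hstep_tuple_class[OF t] show "hstep G (i, False) (cls k) = cls (target i k)"
    "hstep G (i, True) (cls (target i k)) = cls k" by (simp_all add: cls_def)
qed

lemma hstep_cls_letter:
  assumes "i \<in> {2..6}" "k < 40"
  shows "hstep G (i, b) (cls k) = cls (act_letter (i, b) k)" "act_letter (i, b) k < 40"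
proof -
  have lt: "target i k < 40" "target i (target i k) < 40" using assms target_lt by blast+
  \<comment> \<open>\<open>target i\<close> takes \<open>target i (target i k)\<close> back to
    \<open>k\<close>, so the inverse letter leads from \<open>cls k\<close> to that index.\<close>
  show "hstep G (i, b) (cls k) = cls (act_letter (i, b) k)"
    using hstep_cls[OF assms] hstep_cls(2)[OF assms(1) lt(2)] target_target_target[OF assms]
    by (cases b) (simp_all add: act_letter_def)
  show "act_letter (i, b) k < 40" using lt by (simp add: act_letter_def)
qed

lemma base_class: "cls base_index = tuple_class G [s1, s2, s1, s1, s2, s1]"
  by (simp add: cls_def tuple_table_base evw_wa evw_wb)

lemma wact_cls:
  assumes "fst ` set w \<subseteq> {2..6}" "k < 40"
  shows "wact G w (cls k) = cls (act_word w k) \<and> act_word w k < 40"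
  using assms
proof (induction w arbitrary: k)
  case (Cons l w)
  obtain i b where l: "l = (i, b)" by (cases l)
  then show ?case using Cons hstep_cls_letter[of i k b] by (simp add: wact_def act_word_def)
qed (simp add: wact_def act_word_def)

end

section \<open>The orbit and its labels\<close>

locale centreless_braided_pair = braided_pair +
  assumes centre_trivial: "{z \<in> carrier G. \<forall>g \<in> carrier G. z \<otimes> g = g \<otimes> z} = {\<one>}"
begin

text \<open>A common value would generate \<open>G\<close>, hence be central and trivial, contrary
  to the order of \<open>s1 s2 s1\<close>.\<close>

lemma s1_neq_s2: "s1 \<noteq> s2"
proof
  assume eq: "s1 = s2"
  have "s1 \<otimes> g = g \<otimes> s1" if "g \<in> carrier G" for g
  proof -
    have "g \<in> generate G {s1}" using that generated eq by simp
    then obtain k :: int where "g = s1 [^] k" using generate_pow[OF s1] by auto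
    then show ?thesis using int_pow_mult[of s1 1 k] int_pow_mult[of s1 k 1] by (simp add: add.commute)
  qed
  then have "s1 \<in> {z \<in> carrier G. \<forall>g \<in> carrier G. z \<otimes> g = g \<otimes> z}" by simp
  then have "s1 = \<one>" unfolding centre_trivial by simp
  then show False using ord_2 eq by simp
qed

section \<open>Classes labelled by vectors, and transvections realized by braids\<close>

definition Cl :: "3^4 \<Rightarrow> 'a list set" where
  "Cl v = cls (index v)"

lemma Cl_minus [simp]: "v \<noteq> 0 \<Longrightarrow> Cl (- v) = Cl v"
  by (simp add: Cl_def)

lemma Cl_label: "k < 40 \<Longrightarrow> Cl (label k) = cls k"
  by (simp add: Cl_def)

lemma hstep_Cl:
  assumes "i \<in> {2..6}" "v \<noteq> 0"
  shows "hstep G (i, False) (Cl v) = Cl (transv (centre i) v)"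
    "hstep G (i, True) (Cl v) = Cl (transv (centre i) (transv (centre i) v))"
  using hstep_cls_letter(1)[OF assms(1) index(1)[OF assms(2)]] assms
  by (simp_all add: Cl_def index_transv act_letter_def)

definition positive :: "nat list \<Rightarrow> (nat \<times> bool) list" where
  "positive ls = map (\<lambda>i. (i, False)) ls"

text \<open>Positive words suffice, because on the labelled classes the inverse of
  \<open>beta_i\<close> acts as its square.\<close>

definition realized :: "(3^4 \<Rightarrow> 3^4) \<Rightarrow> bool" where
  "realized f \<longleftrightarrow> (\<exists>ls. set ls \<subseteq> {2..6} \<and> (\<forall>v. v \<noteq> 0 \<longrightarrow> wact G (positive ls) (Cl v) = Cl (f v)))"

lemma wact_append: "wact G (w @ w') Y = wact G w' (wact G w Y)"
  by (simp add: wact_def)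

lemma realized_id: "realized (\<lambda>v. v)"
  unfolding realized_def by (intro exI[of _ "[]"]) (simp add: positive_def wact_def)

lemma realized_centre: "i \<in> {2..6} \<Longrightarrow> realized (transv (centre i))"
  unfolding realized_def
  by (intro exI[of _ "[i]"]) (simp add: positive_def wact_def hstep_Cl)

lemma realized_comp:
  assumes "realized f" "realized g" "\<And>v. v \<noteq> 0 \<Longrightarrow> f v \<noteq> 0"
  shows "realized (\<lambda>v. g (f v))"
proof -
  obtain ls js where "set ls \<subseteq> {2..6}" "\<forall>v. v \<noteq> 0 \<longrightarrow> wact G (positive ls) (Cl v) = Cl (f v)"
    "set js \<subseteq> {2..6}" "\<forall>v. v \<noteq> 0 \<longrightarrow> wact G (positive js) (Cl v) = Cl (g v)"
    using assms(1,2) unfolding realized_def by blast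
  then show ?thesis unfolding realized_def
    by (intro exI[of _ "ls @ js"]) (use assms(3) in \<open>simp add: positive_def wact_append\<close>)
qed

text \<open>Induction along the tree of \<open>parent_table\<close>: up to sign the label is the
  image of its parent's label under the transvection of a braid, so \<open>transv_conj\<close> gives
  its transvection as a conjugate, with a square in place of the inverse.\<close>

lemma realized_transv_label: "k < 40 \<Longrightarrow> realized (transv (label k))"
proof (induction k rule: less_induct)
  case (less k)
  show ?case
  proof (cases "k = 0")
    case True
    then show ?thesis using realized_centre[of 2] by (simp add: label_0)
  next
    case False
    then obtain i l where il: "i \<in> {2..6}" "l < k" "target i l = k" using parent[of k] less.prems by auto
    let ?c = "centre i"
    have "transv ?c (label l) \<in> {label k, - label k}" using transv_label[of i l] il less.prems by simp
    then have "transv (label k) = transv (transv ?c (label l))" by (auto simp: fun_eq_iff transv_minus)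
    then have conj: "transv (label k) v = transv ?c (transv (label l) (transv ?c (transv ?c v)))" for v
      using transv_conj[of ?c "label l" "transv ?c (transv ?c v)"] by (simp add: transv_cube)
    have c: "realized (transv ?c)" and l: "realized (transv (label l))"
      using realized_centre il less by auto
    have "realized (\<lambda>v. transv ?c (transv (label l) (transv ?c (transv ?c v))))"
      by (rule realized_comp[OF _ c], rule realized_comp[OF _ l], rule realized_comp[OF c c]) simp_all
    then show ?thesis by (simp only: conj[symmetric])
  qed
qed

lemma realized_transv: "realized (transv c)"
proof (cases "c = 0")
  case True
  then have "transv c = (\<lambda>v. v)" by (simp add: transv_def fun_eq_iff)
  then show ?thesis by (simp add: realized_id)
next
  case False
  then obtain k where k: "k < 40" "c = label k \<or> c = - label k" by (rule label_cover)
  then have "transv c = transv (label k)" by (auto simp: fun_eq_iff transv_minus)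
  then show ?thesis using realized_transv_label k by simp
qed

lemma realized_fold: "realized (fold transv cs)"
proof (induction cs)
  case Nil
  then show ?case using realized_id by (simp add: id_def)
next
  case (Cons c cs)
  then show ?case using realized_comp[OF realized_transv[of c] Cons.IH] by (simp add: comp_def)
qed

text \<open>A word acts on the classes themselves, whichever vectors name them, and so carries a
  coincidence along.\<close>

lemma Cl_fold_transv: "u \<noteq> 0 \<Longrightarrow> v \<noteq> 0 \<Longrightarrow> Cl u = Cl v \<Longrightarrow> Cl (fold transv cs u) = Cl (fold transv cs v)"
  using realized_fold[of cs] unfolding realized_def by metis

section \<open>Distinct lines label distinct classes\<close>

lemma base_nonzero: "label base_index \<noteq> 0"
  by (simp add: label_nonzero)

lemma Cl_base: "Cl (label base_index) = tuple_class G [s1, s2, s1, s1, s2, s1]"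
  by (simp add: Cl_label base_class)

text \<open>\<open>beta_2\<close> puts \<open>s1\<close> in both the second and the third place,
  where the base tuple has \<open>s2\<close> and \<open>s1\<close>. A single conjugation matching
  the two tuples would force \<open>s1 = s2\<close>.\<close>

lemma Cl_base_moved: "Cl (transv (centre 2) (label base_index)) \<noteq> Cl (label base_index)"
proof
  let ?t = "[s1, s2, s1, s1, s2, s1]"
  assume eq: "Cl (transv (centre 2) (label base_index)) = Cl (label base_index)"
  have "Cl (transv (centre 2) (label base_index)) = hstep G (2, False) (tuple_class G ?t)"
    using hstep_Cl(1)[of 2 "label base_index"] base_nonzero by (simp add: Cl_base)
  also have "\<dots> = tuple_class G (hur_tup G 2 ?t)" by (rule hstep_tuple_class) auto
  also have "hur_tup G 2 ?t = [conjg G s1 s2, s1, s1, s1, s2, s1]" by (simp add: hur_tup_def)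
  finally have "?t \<in> tuple_class G [conjg G s1 s2, s1, s1, s1, s2, s1]"
    using mem_tuple_class[of ?t] eq Cl_base by simp
  then obtain g where "s2 = conjg G g s1" "s1 = conjg G g s1" by (auto simp: tuple_class_def)
  then show False using s1_neq_s2 by simp
qed

text \<open>A nontrivial coincidence would propagate to all hyperbolic pairs, by transitivity of the
  transvections on them.\<close>

lemma Cl_hyperbolic_neq:
  assumes "sform u v \<noteq> 0"
  shows "Cl u \<noteq> Cl v"
proof
  assume eq: "Cl u = Cl v"
  have nz: "u \<noteq> 0" "v \<noteq> 0" using assms by auto
  obtain v' where v': "sform u v' = 1" "Cl u = Cl v'" "v' \<noteq> 0"
  proof (cases "sform u v = 1")
    case False
    then have "sform u (- v) = 1" using assms F3_cases[of "sform u v"] by auto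
    then show ?thesis using that[of "- v"] eq nz by simp
  qed (use that eq nz in blast)
  let ?b = "label base_index" and ?c = "centre 2"
  \<comment> \<open>By \<open>sform_base\<close> the moved base vector or its negative pairs to 1
    with the base vector. That one becomes \<open>x\<close>; the sign does not affect the
    class.\<close>
  let ?b' = "- transv ?c ?b"
  have "sform ?b ?b' = -1 \<or> sform ?b ?b' = 1" by (simp add: transv_def sform_base)
  moreover have "sform ?b ?b' \<noteq> -1 \<or> sform ?b (transv ?c ?b) = 1" by simp
  ultimately obtain x where x: "sform ?b x = 1" "x = ?b' \<or> x = transv ?c ?b" by blast
  obtain cs where "fold transv cs u = ?b" "fold transv cs v' = x"
    using whole.transitive_hyperbolic[of u v' ?b x] v'(1) x(1) by auto
  then have "Cl ?b = Cl x" using Cl_fold_transv[OF nz(1) v'(3) v'(2), of cs] by simp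
  moreover have "transv ?c ?b \<noteq> 0" using base_nonzero by simp
  ultimately show False using x(2) Cl_base_moved Cl_minus by metis
qed

text \<open>For orthogonal vectors on different lines some \<open>c\<close> is orthogonal to
  \<open>u\<close> but not to \<open>v\<close>. Its transvection fixes \<open>u\<close> and moves
  \<open>v\<close> to a vector not orthogonal to \<open>v\<close>, which leads back to the
  hyperbolic case.\<close>

lemma Cl_eq_iff:
  assumes nz: "u \<noteq> 0" "v \<noteq> 0"
  shows "Cl u = Cl v \<longleftrightarrow> u = v \<or> u = - v"
proof
  assume eq: "Cl u = Cl v"
  then have uv: "sform u v = 0" using Cl_hyperbolic_neq by blast
  show "u = v \<or> u = - v"
  proof (rule ccontr)
    assume ne: "\<not> (u = v \<or> u = - v)"
    obtain c where c: "sform u c = 0" "sform v c \<noteq> 0"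
    proof (rule ccontr)
      assume "\<not> thesis"
      with that have perp: "sform v c = 0" if "sform u c = 0" for c using that by blast
      obtain y where y: "sform u y \<noteq> 0" using sform_nondegenerate nz(1) by blast
      \<comment> \<open>The ratio of \<open>sform v y\<close> to \<open>sform u y\<close>, written
        as a product because nonzero scalars of F_3 are their own inverses.\<close>
      let ?a = "sform u y * sform v y"
      have "sform (v - ?a *s u) z = 0" for z
      proof -
        have "sform u (z - (sform u z * sform u y) *s y) = 0"
          using F3_square[OF y] by (simp add: mult.assoc)
        from perp[OF this] show ?thesis by (simp add: algebra_simps)
      qed
      then have "v - ?a *s u = 0" using sform_nondegenerate by blast
      then have v: "v = ?a *s u" by simp
      have "v = 0 \<or> v = u \<or> v = - u"
        using F3_cases[of ?a] v by (metis vector_smult_lzero vector_smult_lid vector_sneg_minus1)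
      then show False using ne nz by auto
    qed
    have "Cl (transv c u) = Cl (transv c v)" using Cl_fold_transv[OF nz eq, of "[c]"] by simp
    then have "Cl v = Cl (transv c v)" using c(1) eq by (simp add: transv_fix)
    moreover have "sform v (transv c v) \<noteq> 0" using F3_square[OF c(2)] by (simp add: transv_def)
    ultimately show False using Cl_hyperbolic_neq by blast
  qed
qed (use nz in auto)

text \<open>Defined through labels; \<open>orbit_gen_eq_Z\<close> identifies it with the orbits of
  both braid groups.\<close>

definition Z :: "'a list set set" where
  "Z = Cl ` (- {0})"

lemma Cl_in_Z: "v \<noteq> 0 \<Longrightarrow> Cl v \<in> Z"
  by (simp add: Z_def)

lemma Z_eq_cls: "Z = cls ` {..<40}"
proof
  show "Z \<subseteq> cls ` {..<40}" using index(1) by (auto simp: Z_def Cl_def)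
  show "cls ` {..<40} \<subseteq> Z" using Cl_in_Z label_nonzero by (auto simp flip: Cl_label)
qed

lemma inj_cls: "inj_on cls {..<40}"
proof (rule inj_onI)
  fix k l assume kl: "k \<in> {..<40}" "l \<in> {..<40::nat}" "cls k = cls l"
  then have "Cl (label k) = Cl (label l)" by (simp add: Cl_label)
  then show "k = l" using kl label_unique[of k l] label_nonzero by (simp add: Cl_eq_iff)
qed

lemma card_Z: "card Z = 40"
  using inj_cls by (simp add: Z_eq_cls card_image)

lemma finite_Z: "finite Z"
  by (simp add: Z_eq_cls)

text \<open>The base tuple qualifies: its product is the square of \<open>s1 s2 s1\<close>, and
  conjugation by \<open>s1 s2\<close> takes \<open>s1\<close> to \<open>s2\<close>. Positive words
  preserve generating systems and reach every labelled class.\<close>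

lemma Z_subset_Sigma_i: "Z \<subseteq> Sigma_i G (replicate 6 (conj_class G s1))"
proof -
  let ?D = "replicate 6 (conj_class G s1)"
  have step: "hstep G (i, False) Y \<in> Sigma_i G ?D" if i: "i \<in> {2..6}" and Y: "Y \<in> Sigma_i G ?D" for i Y
  proof -
    obtain t where t: "t \<in> gen_systems G ?D" "Y = tuple_class G t" using Y by (auto simp: Sigma_i_def)
    then have "length t = 6" "set t \<subseteq> carrier G"
      using conj_class_carrier[OF s1] by (auto simp: gen_systems_replicate)
    then have "hstep G (i, False) Y = tuple_class G (hur_tup G i t)"
      using i t(2) by (simp add: hstep_tuple_class)
    moreover have "hur_tup G i t \<in> gen_systems G ?D" using i t(1) by (intro hur_tup_gen_systems) auto
    ultimately show ?thesis by (simp add: Sigma_i_def)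
  qed
  have "conjg G (s1 \<otimes> s2) s1 = s2"
    using braid by (simp add: conjg_def inv_mult_group m_assoc)
  then have "s2 \<in> conj_class G s1" unfolding conj_class_def by (auto intro!: exI[of _ "s1 \<otimes> s2"])
  moreover have "s1 \<in> conj_class G s1" unfolding conj_class_def by (auto intro!: exI[of _ "\<one>"])
  moreover have "tuple_prod G [s1, s2, s1, s1, s2, s1] = \<one>"
    using ev_S_S by (simp add: tuple_prod_def m_assoc)
  moreover have "set [s1, s2, s1, s1, s2, s1] = {s1, s2}" by auto
  ultimately have "[s1, s2, s1, s1, s2, s1] \<in> gen_systems G ?D"
    using generated by (simp add: gen_systems_replicate)
  then have base: "Cl (label base_index) \<in> Sigma_i G ?D" by (simp add: Cl_base Sigma_i_def)
  have "Cl v \<in> Sigma_i G ?D" if v: "v \<noteq> 0" for v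
  proof -
    obtain cs where cs: "fold transv cs (label base_index) = v"
      using whole.transitive[of "label base_index" v] v base_nonzero by auto
    obtain ls where ls: "set ls \<subseteq> {2..6}" "wact G (positive ls) (Cl (label base_index)) = Cl v"
      using realized_fold[of cs] base_nonzero cs unfolding realized_def by blast
    have "wact G (positive ls) Y \<in> Sigma_i G ?D" if "Y \<in> Sigma_i G ?D" for Y
      using that ls(1) by (induction ls arbitrary: Y) (auto simp: positive_def wact_def step)
    then show ?thesis using base ls(2) by metis
  qed
  then show ?thesis by (auto simp: Z_def)
qed

section \<open>Cycle types and genus\<close>

lemma rho_cls: "fst ` set w \<subseteq> {2..6} \<Longrightarrow> k < 40 \<Longrightarrow> rho G Z w (cls k) = cls (act_word w k)"
  using wact_cls by (simp add: rho_def Z_eq_cls)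

lemma cycle_type_rho:
  assumes w: "fst ` set w \<subseteq> {2..6}"
    and cube: "\<forall>k\<in>set [0..<40]. act_word w (act_word w (act_word w k)) = k"
    and fixed: "length (filter (\<lambda>k. act_word w k = k) [0..<40]) = 13"
  shows "cycle_type (rho G Z w) Z = replicate_mset 13 1 + replicate_mset 9 3"
proof (rule cycle_type_order_3)
  define f where "f = rho G Z w"
  have lt: "act_word w k < 40" and f: "f (cls k) = cls (act_word w k)" if "k < 40" for k
    using wact_cls[OF w that] rho_cls[OF w that] by (simp_all add: f_def)
  show "rho G Z w Y \<in> Z" if "Y \<in> Z" for Y
    using that lt unfolding f_def[symmetric] unfolding Z_eq_cls by (auto simp: f)
  show "rho G Z w (rho G Z w (rho G Z w Y)) = Y" if "Y \<in> Z" for Y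
    using that cube lt unfolding f_def[symmetric] unfolding Z_eq_cls by (auto simp: f)
  have "f (cls k) = cls k \<longleftrightarrow> act_word w k = k" if "k < 40" for k
    using inj_cls lt[OF that] that by (simp add: f inj_on_eq_iff)
  then have "{Y \<in> Z. rho G Z w Y = Y} = cls ` {k. k < 40 \<and> act_word w k = k}"
    unfolding f_def[symmetric] unfolding Z_eq_cls by blast
  moreover have "inj_on cls {k. k < 40 \<and> act_word w k = k}"
    using inj_cls by (rule inj_on_subset) auto
  moreover have "{k. k < 40 \<and> act_word w k = k} = set (filter (\<lambda>k. act_word w k = k) [0..<40])"
    by auto
  ultimately show "card {Y \<in> Z. rho G Z w Y = Y} = 13"
    using fixed by (simp only: card_image distinct_card[OF distinct_filter[OF distinct_upt]])
qed (simp_all add: finite_Z card_Z)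

lemma beta_ij_letters: "1 \<le> i \<Longrightarrow> i < j \<Longrightarrow> j \<le> 6 \<Longrightarrow> fst ` set (beta_ij_word i j) \<subseteq> {2..6}"
  by (auto simp: beta_ij_word_def)

lemma cycle_type_beta_ij:
  assumes "1 \<le> i" "i < j" "j \<le> 6"
  shows "cycle_type (rho G Z (beta_ij_word i j)) Z = replicate_mset 13 1 + replicate_mset 9 3"
proof -
  have "j \<in> set [2,3,4,5,6]" "i \<in> set [1..<j]" using assms letter_index[of j] by simp_all
  from bspec[OF bspec[OF beta_ij_table this(1)] this(2)] show ?thesis
    by (intro cycle_type_rho beta_ij_letters assms) blast+
qed

lemma cycle_type_beta:
  assumes "2 \<le> j" "j \<le> 6"
  shows "cycle_type (rho G Z (beta_word j)) Z = replicate_mset 13 1 + replicate_mset 9 3"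
proof -
  have j: "j \<in> {2..6}" "j \<in> set [2,3,4,5,6]" using assms letter_index[of j] by simp_all
  show ?thesis
  proof (rule cycle_type_rho)
    show "fst ` set (beta_word j) \<subseteq> {2..6}" using assms by (simp add: beta_word_def)
    show "\<forall>k\<in>set [0..<40]. act_word (beta_word j) (act_word (beta_word j) (act_word (beta_word j) k)) = k"
      using target_target_target[OF j(1)] by (simp add: beta_word_def act_word_def act_letter_def)
    show "length (filter (\<lambda>k. act_word (beta_word j) k = k) [0..<40]) = 13"
      by (rule bspec[OF beta_table j(2)])
  qed
qed

text \<open>Each of the five braids \<open>beta_1j\<close> has 13 + 9 = 22 cycles, and 1 - 40 + (5 *
  40 - 5 * 22) / 2 = 6.\<close>

lemma genus_Z: "genus G 6 Z = 6"
proof -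
  have "card (cycles_on f Y) = size (cycle_type f Y)" for f :: "'a list set \<Rightarrow> 'a list set" and Y
    by (simp add: cycle_type_def)
  then have "card (cycles_on (rho G Z (beta_ij_word 1 j)) Z) = 22" if "j \<in> {2..6}" for j
    using that cycle_type_beta_ij[of 1 j] by simp
  then show ?thesis by (simp add: genus_def card_Z)
qed

subsection \<open>The orbit\<close>

text \<open>Captures what the generators of \<open>H_6\<close> and of \<open>B_6\<close> share, so
  that orbit and permutation group are determined once for both.\<close>

definition generates :: "(nat \<times> bool) list set \<Rightarrow> bool" where
  "generates Ws \<longleftrightarrow> (\<forall>w\<in>Ws. fst ` set w \<subseteq> {2..6}) \<and>
     (\<forall>i\<in>{2..6}. \<exists>us\<in>lists Ws. \<forall>k<40. wact G (concat us) (cls k) = cls (target i k))"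

lemma generates_H: "generates (H_gens 6)"
  unfolding generates_def
proof (intro conjI ballI)
  show "fst ` set w \<subseteq> {2..6}" if "w \<in> H_gens 6" for w
    using that by (auto simp: H_gens_def beta_word_def)
  show "\<exists>us\<in>lists (H_gens 6). \<forall>k<40. wact G (concat us) (cls k) = cls (target i k)" if i: "i \<in> {2..6}" for i
  proof (rule bexI[of _ "[beta_word i]"])
    show "[beta_word i] \<in> lists (H_gens 6)" using i by (auto simp: H_gens_def)
    show "\<forall>k<40. wact G (concat [beta_word i]) (cls k) = cls (target i k)"
      using hstep_cls(1)[OF i] by (simp add: beta_word_def wact_def)
  qed
qed

lemma generates_B: "generates (B_gens 6)"
  unfolding generates_def
proof (intro conjI ballI)
  show "fst ` set w \<subseteq> {2..6}" if "w \<in> B_gens 6" for w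
  proof -
    from that obtain i j where "w = beta_ij_word i j" "1 \<le> i" "i < j" "j \<le> 6" by (auto simp: B_gens_def)
    then show ?thesis using beta_ij_letters by metis
  qed
  show "\<exists>us\<in>lists (B_gens 6). \<forall>k<40. wact G (concat us) (cls k) = cls (target i k)" if i: "i \<in> {2..6}" for i
  \<comment> \<open>The pure braid of neighbouring strands is the square of \<open>beta_i\<close>;
    applied twice it gives the fourth power, which acts on the orbit as
    \<open>beta_i\<close>.\<close>
  proof (rule bexI[of _ "[beta_ij_word (i - 1) i, beta_ij_word (i - 1) i]"])
    have "1 \<le> i - 1" "i - 1 < i" "i \<le> 6" using i by auto
    then have "beta_ij_word (i - 1) i \<in> B_gens 6" unfolding B_gens_def by blast
    then show "[beta_ij_word (i - 1) i, beta_ij_word (i - 1) i] \<in> lists (B_gens 6)" by simp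
    have "beta_ij_word (i - 1) i = [(i, False), (i, False)]" using i by (simp add: beta_ij_word_def)
    then show "\<forall>k<40. wact G (concat [beta_ij_word (i - 1) i, beta_ij_word (i - 1) i]) (cls k) = cls (target i k)"
      using hstep_cls(1)[OF i] target_lt[OF i] target_target_target[OF i] by (simp add: wact_def)
  qed
qed

lemma positive_word_expressible:
  assumes "generates Ws" "set ls \<subseteq> {2..6}"
  shows "\<exists>us\<in>lists Ws. \<forall>k<40. wact G (concat us) (cls k) = wact G (positive ls) (cls k)"
  using assms(2)
proof (induction ls)
  case Nil
  show ?case by (rule bexI[of _ "[]"]) (simp_all add: positive_def)
next
  case (Cons i ls)
  then have i: "i \<in> {2..6}" by simp
  obtain us where us: "us \<in> lists Ws" "\<forall>k<40. wact G (concat us) (cls k) = wact G (positive ls) (cls k)"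
    using Cons by auto
  obtain vs where vs: "vs \<in> lists Ws" "\<forall>k<40. wact G (concat vs) (cls k) = cls (target i k)"
    using assms(1) i unfolding generates_def by blast
  have "wact G (positive (i # ls)) (cls k) = wact G (positive ls) (cls (target i k))" if "k < 40" for k
    using hstep_cls(1)[OF i that] by (simp add: positive_def wact_def)
  then have "\<forall>k<40. wact G (concat (vs @ us)) (cls k) = wact G (positive (i # ls)) (cls k)"
    using us(2) vs(2) target_lt[OF i] by (simp add: wact_append)
  then show ?case using us(1) vs(1) by (intro bexI[of _ "vs @ us"]) auto
qed

text \<open>All letters preserve the 40 classes, and transitivity of the transvections on nonzero
  vectors, rewritten in the generators, reaches each of them.\<close>

lemma orbit_gen_eq_Z:
  assumes "generates Ws" "v \<noteq> 0"
  shows "orbit_gen G Ws (Cl v) = Z"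
proof
  have letters: "fst ` set (concat ws) \<subseteq> {2..6}" if ws: "ws \<in> lists (Ws \<union> inv_word ` Ws)" for ws
  proof -
    have inv: "fst ` set (inv_word w) = fst ` set w" for w by (force simp: inv_word_def)
    have Ws: "fst ` set w \<subseteq> {2..6}" if "w \<in> Ws" for w
      using that assms(1) unfolding generates_def by blast
    have "fst ` set w \<subseteq> {2..6}" if "w \<in> set ws" for w
      using that ws Ws inv by blast
    then show ?thesis unfolding set_concat by blast
  qed
  show "orbit_gen G Ws (Cl v) \<subseteq> Z"
    using wact_cls[OF letters] index(1)[OF assms(2)] by (auto simp: orbit_gen_def Cl_def Z_eq_cls)
  show "Z \<subseteq> orbit_gen G Ws (Cl v)"
  proof
    fix Y assume "Y \<in> Z"
    then obtain u where u: "u \<noteq> 0" "Y = Cl u" by (auto simp: Z_def)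
    obtain cs where cs: "fold transv cs v = u" using whole.transitive[of v u] u assms(2) by auto
    obtain ls where "set ls \<subseteq> {2..6}" "wact G (positive ls) (Cl v) = Y"
      using realized_fold[of cs] cs assms(2) u unfolding realized_def by blast
    then obtain us where "us \<in> lists Ws" "wact G (concat us) (Cl v) = Y"
      using positive_word_expressible[OF assms(1)] index(1)[OF assms(2)] unfolding Cl_def by metis
    then show "Y \<in> orbit_gen G Ws (Cl v)" unfolding orbit_gen_def by blast
  qed
qed

subsection \<open>The permutation group\<close>

text \<open>By \<open>Cl_eq_iff\<close> the chosen vector is determined up to sign, which does not
  change the resulting class. The restriction to \<open>Z\<close> makes the map extensional, as
  \<open>Bij\<close> demands.\<close>

definition proj_action :: "3^4^4 \<Rightarrow> 'a list set \<Rightarrow> 'a list set" where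
  "proj_action A = (\<lambda>Y\<in>Z. Cl (A *v (SOME v. v \<noteq> 0 \<and> Cl v = Y)))"

lemma proj_action_Cl:
  assumes "A \<in> carrier Sp43" "v \<noteq> 0"
  shows "proj_action A (Cl v) = Cl (A *v v)"
proof -
  let ?u = "SOME u. u \<noteq> 0 \<and> Cl u = Cl v"
  have "?u \<noteq> 0 \<and> Cl ?u = Cl v" by (rule someI[of _ v]) (simp add: assms(2))
  then have "?u = v \<or> ?u = - v" using Cl_eq_iff assms(2) by blast
  moreover have "A *v v \<noteq> 0" using Sp43_nonzero assms by blast
  ultimately have "Cl (A *v ?u) = Cl (A *v v)" by auto
  then show ?thesis using Cl_in_Z[OF assms(2)] by (simp add: proj_action_def)
qed

lemma Sp43_closed: "A \<in> carrier Sp43 \<Longrightarrow> v \<noteq> 0 \<Longrightarrow> A *v v \<noteq> 0"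
  using Sp43_nonzero by blast

lemma extensional_Z_eqI:
  "f \<in> extensional Z \<Longrightarrow> g \<in> extensional Z \<Longrightarrow> (\<And>v. v \<noteq> 0 \<Longrightarrow> f (Cl v) = g (Cl v)) \<Longrightarrow> f = g"
  by (rule extensionalityI) (auto simp: Z_def)

lemma proj_action_Bij:
  assumes A: "A \<in> carrier Sp43"
  shows "proj_action A \<in> Bij Z"
proof -
  obtain B where B: "B \<in> carrier Sp43" "B ** A = mat 1" using Sp43_left_inverse[OF A] .
  have into: "proj_action A ` Z \<subseteq> Z"
    by (auto simp: Z_def proj_action_Cl A Sp43_closed)
  have "proj_action B (proj_action A Y) = Y" if "Y \<in> Z" for Y
    using that B(2) by (auto simp: Z_def proj_action_Cl A B(1) Sp43_closed matrix_vector_mul_assoc)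
  then have "inj_on (proj_action A) Z" by (metis inj_onI)
  then have "bij_betw (proj_action A) Z Z"
    using into finite_Z by (simp add: bij_betw_def endo_inj_surj)
  then show ?thesis by (simp add: Bij_def proj_action_def)
qed

lemma proj_action_hom: "proj_action \<in> hom Sp43 (BijGroup Z)"
proof (rule homI)
  show "proj_action A \<in> carrier (BijGroup Z)" if "A \<in> carrier Sp43" for A
    using that by (simp add: BijGroup_def proj_action_Bij)
  fix A B assume AB: "A \<in> carrier Sp43" "B \<in> carrier Sp43"
  have "proj_action (A ** B) = compose Z (proj_action A) (proj_action B)"
    by (rule extensional_Z_eqI)
      (simp_all add: AB mult_in_Sp43 proj_action_Cl Sp43_closed compose_eq Cl_in_Z
        matrix_vector_mul_assoc, simp add: proj_action_def)
  then show "proj_action (A \<otimes>\<^bsub>Sp43\<^esub> B) = proj_action A \<otimes>\<^bsub>BijGroup Z\<^esub> proj_action B"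
    using AB by (simp add: Sp43_mult BijGroup_def proj_action_Bij)
qed

lemma rho_eq_proj_action:
  assumes "A \<in> carrier Sp43" "\<And>v. v \<noteq> 0 \<Longrightarrow> wact G w (Cl v) = Cl (A *v v)"
  shows "rho G Z w = proj_action A"
  by (rule extensional_Z_eqI) (simp_all add: rho_def assms proj_action_Cl Cl_in_Z, simp add: proj_action_def)

lemma word_matrix:
  assumes "fst ` set w \<subseteq> {2..6}"
  obtains A where "A \<in> carrier Sp43" "\<And>v. v \<noteq> 0 \<Longrightarrow> wact G w (Cl v) = Cl (A *v v)"
  using assms
proof (induction w arbitrary: thesis)
  case Nil
  then show ?case using mat_1_in_Sp43 by (simp add: wact_def)
next
  case (Cons l w)
  obtain i b where l: "l = (i, b)" by (cases l)
  then have i: "i \<in> {2..6}" using Cons.prems(2) by simp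
  obtain A where A: "A \<in> carrier Sp43" "\<And>v. v \<noteq> 0 \<Longrightarrow> wact G w (Cl v) = Cl (A *v v)"
    using Cons.IH Cons.prems(2) by auto
  define M where "M = (if b then transv_mat (centre i) ** transv_mat (centre i) else transv_mat (centre i))"
  have M: "M \<in> carrier Sp43" by (simp add: M_def transv_mat_in_Sp43 mult_in_Sp43)
  have "hstep G l (Cl v) = Cl (M *v v)" if "v \<noteq> 0" for v
    using hstep_Cl[OF i that] by (simp add: l M_def transv_mat flip: matrix_vector_mul_assoc)
  \<comment> \<open>The first letter acts first and so becomes the rightmost matrix factor.\<close>
  then have "wact G (l # w) (Cl v) = Cl ((A ** M) *v v)" if "v \<noteq> 0" for v
    using A(2)[OF Sp43_closed[OF M that]] that by (simp add: wact_def flip: matrix_vector_mul_assoc)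
  then show ?case using Cons.prems(1) mult_in_Sp43[OF A(1) M] by blast
qed

text \<open>Words act from left to right while maps compose from right to left, so
  \<open>rho\<close> reverses products.\<close>

lemma rho_append:
  assumes "fst ` set w \<subseteq> {2..6}" "fst ` set w' \<subseteq> {2..6}"
  shows "rho G Z (w @ w') = rho G Z w' \<otimes>\<^bsub>BijGroup Z\<^esub> rho G Z w"
proof -
  obtain A where A: "A \<in> carrier Sp43" "\<And>v. v \<noteq> 0 \<Longrightarrow> wact G w (Cl v) = Cl (A *v v)"
    using word_matrix[OF assms(1)] by metis
  obtain B where B: "B \<in> carrier Sp43" "\<And>v. v \<noteq> 0 \<Longrightarrow> wact G w' (Cl v) = Cl (B *v v)"
    using word_matrix[OF assms(2)] by metis
  have "rho G Z (w @ w') = proj_action (B ** A)"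
    using A B by (intro rho_eq_proj_action)
      (simp_all add: mult_in_Sp43 wact_append Sp43_closed flip: matrix_vector_mul_assoc)
  also have "\<dots> = proj_action B \<otimes>\<^bsub>BijGroup Z\<^esub> proj_action A"
    using hom_mult[OF proj_action_hom B(1) A(1)] by (simp add: Sp43_mult)
  finally show ?thesis using rho_eq_proj_action[OF A] rho_eq_proj_action[OF B] by simp
qed

lemma Sp43_realized:
  assumes "A \<in> carrier Sp43"
  obtains ls where "set ls \<subseteq> {2..6}" "rho G Z (positive ls) = proj_action A"
proof -
  \<comment> \<open>The product of transvections undoes the isometry it is built from, so it is
    built from the inverse of \<open>A\<close>.\<close>
  obtain B where B: "B \<in> carrier Sp43" "B ** A = mat 1" using Sp43_left_inverse[OF assms] .
  have "\<exists>cs. \<forall>v. fold transv cs (B *v v) = v"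
    using B(1) by (intro symp_isometry_is_transv_prod) (simp_all add: Sp43_iff matrix_vector_add)
  then obtain cs where "\<And>v. fold transv cs (B *v v) = v" by blast
  then have cs: "fold transv cs v = A *v v" for v
    using B(2) matrix_vector_mul_assoc matrix_vector_mul_lid by metis
  obtain ls where "set ls \<subseteq> {2..6}" "\<forall>v. v \<noteq> 0 \<longrightarrow> wact G (positive ls) (Cl v) = Cl (A *v v)"
    using realized_fold[of cs] unfolding realized_def cs by blast
  then show ?thesis using that rho_eq_proj_action[OF assms] by metis
qed

text \<open>The right-hand side does not depend on \<open>Ws\<close>, which is why pure and full
  braid group have the same image.\<close>

lemma generate_rho:
  assumes "generates Ws"
  shows "generate (BijGroup Z) (rho G Z ` Ws) = proj_action ` carrier Sp43"
proof
  interpret hom: group_hom Sp43 "BijGroup Z" proj_action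
    using group_Sp43 group_BijGroup proj_action_hom by (simp add: group_hom_def group_hom_axioms_def)
  have "rho G Z w \<in> proj_action ` carrier Sp43" if w: "w \<in> Ws" for w
  proof -
    have "fst ` set w \<subseteq> {2..6}" using assms w by (simp add: generates_def)
    then obtain A where "A \<in> carrier Sp43" "\<And>v. v \<noteq> 0 \<Longrightarrow> wact G w (Cl v) = Cl (A *v v)"
      by (rule word_matrix) blast
    then show ?thesis using rho_eq_proj_action by blast
  qed
  then show "generate (BijGroup Z) (rho G Z ` Ws) \<subseteq> proj_action ` carrier Sp43"
    using hom.img_is_subgroup by (intro group.generate_subgroup_incl[OF group_BijGroup]) auto
  show "proj_action ` carrier Sp43 \<subseteq> generate (BijGroup Z) (rho G Z ` Ws)"
  proof
    fix f assume "f \<in> proj_action ` carrier Sp43"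
    then obtain ls where ls: "set ls \<subseteq> {2..6}" "rho G Z (positive ls) = f"
      using Sp43_realized by (metis imageE)
    obtain us where us: "us \<in> lists Ws" "\<forall>k<40. wact G (concat us) (cls k) = wact G (positive ls) (cls k)"
      using positive_word_expressible[OF assms ls(1)] by blast
    have "rho G Z (concat us) = f"
      unfolding ls(2)[symmetric] rho_def by (rule restrict_ext) (use us(2) in \<open>auto simp: Z_eq_cls\<close>)
    moreover have "rho G Z (concat us) \<in> generate (BijGroup Z) (rho G Z ` Ws)"
      using us(1)
    proof (induction us)
      case Nil
      have "rho G Z [] = \<one>\<^bsub>BijGroup Z\<^esub>" by (simp add: rho_def wact_def BijGroup_def)
      then show ?case by (simp add: generate.one)
    next
      case (Cons w us)
      have Ws: "fst ` set w' \<subseteq> {2..6}" if "w' \<in> Ws" for w'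
        using that assms unfolding generates_def by blast
      have "w \<in> Ws" "set us \<subseteq> Ws" using Cons.hyps by auto
      then have letters: "fst ` set w \<subseteq> {2..6}" "fst ` set (concat us) \<subseteq> {2..6}"
        using Ws unfolding set_concat by blast+
      show ?case using Cons by (auto simp: rho_append[OF letters] intro: generate.eng generate.incl)
    qed
    ultimately show "f \<in> generate (BijGroup Z) (rho G Z ` Ws)" by simp
  qed
qed

text \<open>First isomorphism theorem: a matrix in the kernel fixes every line, so
  \<open>Sp43_projective_kernel\<close> leaves only the identity and its negative.\<close>

lemma rho_group_iso:
  assumes "generates Ws"
  shows "rho_group G Z Ws \<cong> PSp43"
proof -
  interpret hom: group_hom Sp43 "BijGroup Z" proj_action
    using group_Sp43 group_BijGroup proj_action_hom by (simp add: group_hom_def group_hom_axioms_def)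
  let ?H = "(BijGroup Z)\<lparr>carrier := proj_action ` carrier Sp43\<rparr>"
  have H: "rho_group G Z Ws = ?H" by (simp add: rho_group_def generate_rho[OF assms])
  have "group ?H" using hom.img_is_subgroup group_BijGroup by (rule subgroup.subgroup_is_group)
  then interpret surj: group_hom Sp43 ?H proj_action
    using group_Sp43 proj_action_hom by (simp add: group_hom_def group_hom_axioms_def hom_def)
  have "kernel Sp43 ?H proj_action = {mat 1, - mat 1}"
  proof
    show "kernel Sp43 ?H proj_action \<subseteq> {mat 1, - mat 1}"
    proof
      fix A assume "A \<in> kernel Sp43 ?H proj_action"
      then have A: "A \<in> carrier Sp43" "proj_action A = (\<lambda>Y\<in>Z. Y)" by (simp_all add: kernel_def BijGroup_def)
      have "A *v v = v \<or> A *v v = - v" for v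
      proof (cases "v = 0")
        case False
        then have "Cl (A *v v) = Cl v" using proj_action_Cl[OF A(1), of v] by (simp add: A(2) Cl_in_Z)
        then show ?thesis using Cl_eq_iff False Sp43_closed A(1) by blast
      qed simp
      then show "A \<in> {mat 1, - mat 1}" using Sp43_projective_kernel[OF A(1)] by simp
    qed
    have "proj_action A = (\<lambda>Y\<in>Z. Y)" if "A \<in> {mat 1, - mat 1}" for A
      using that mat_1_in_Sp43 minus_mat_1_in_Sp43
      by (intro extensional_Z_eqI) (auto simp: proj_action_Cl Cl_in_Z, simp_all add: proj_action_def)
    then show "{mat 1, - mat 1} \<subseteq> kernel Sp43 ?H proj_action"
      using mat_1_in_Sp43 minus_mat_1_in_Sp43 by (auto simp: kernel_def BijGroup_def)
  qed
  moreover have "Sp43 Mod (kernel Sp43 ?H proj_action) \<cong> ?H" by (rule surj.FactGroup_iso) simp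
  moreover have "group (Sp43 Mod (kernel Sp43 ?H proj_action))"
    by (rule normal.factorgroup_is_group[OF surj.normal_kernel])
  ultimately show ?thesis unfolding H PSp43_def by (metis group.iso_sym)
qed

end

theorem theorem9:
  fixes G (structure) and s1 s2 :: 'a
  assumes "group G" and "finite (carrier G)" and "carrier G \<noteq> {\<one>}"
    and "{z \<in> carrier G. \<forall>g \<in> carrier G. z \<otimes> g = g \<otimes> z} = {\<one>}"
    and "s1 \<in> carrier G" and "s2 \<in> carrier G"
    and "generate G {s1, s2} = carrier G"
    and "s1 \<otimes> s2 \<otimes> s1 = s2 \<otimes> s1 \<otimes> s2"
    and "group.ord G (s1 \<otimes> s2 \<otimes> s1) = 2"
  defines "C \<equiv> conj_class G s1"
    and "x \<equiv> tuple_class G [s1, s2, s1, s1, s2, s1]"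
    and "Z \<equiv> orbit_gen G (B_gens 6) (tuple_class G [s1, s2, s1, s1, s2, s1])"
  shows "Z = orbit_gen G (H_gens 6) x
    \<and> Z \<subseteq> Sigma_i G (replicate 6 C)
    \<and> card Z = 40
    \<and> (\<forall>i j. 1 \<le> i \<and> i < j \<and> j \<le> 6 \<longrightarrow>
          cycle_type (rho G Z (beta_ij_word i j)) Z = replicate_mset 13 1 + replicate_mset 9 3)
    \<and> rho_group G Z (B_gens 6) \<cong> PSp43
    \<and> (\<forall>j. 2 \<le> j \<and> j \<le> 6 \<longrightarrow>
          cycle_type (rho G Z (beta_word j)) Z = replicate_mset 13 1 + replicate_mset 9 3)
    \<and> rho_group G Z (H_gens 6) \<cong> PSp43
    \<and> genus G 6 Z = 6"
proof -
  interpret P: centreless_braided_pair G s1 s2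
    using assms(1,4-9)
    by (simp add: centreless_braided_pair_def centreless_braided_pair_axioms_def
      braided_pair_def braided_pair_axioms_def)
  have Z: "Z = P.Z" and "orbit_gen G (H_gens 6) x = P.Z"
    unfolding Z_def x_def P.Cl_base[symmetric]
    by (rule P.orbit_gen_eq_Z; simp add: P.generates_B P.generates_H P.base_nonzero)+
  then show ?thesis
    unfolding C_def Z
    using P.Z_subset_Sigma_i P.card_Z P.cycle_type_beta_ij P.cycle_type_beta P.genus_Z
      P.rho_group_iso[OF P.generates_B] P.rho_group_iso[OF P.generates_H] by simp
qed

end
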